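(* Let $\mathbb{C}$ be a ribbon category and $A$ a reflexive object of $\mathbb{C}$ with isomorphism $\varphi:A\otimes A^*\to A$. Then $\mathcal{A}=\mathbb{C}(I,A)$ with application $a\,b:=(a\otimes b);\mathbf{app}$ is a balanced extensional $\mathbf{BC^{\pm}I}$-algebra with $\mathbf{B}=F(\mathbf{app})$, $\mathbf{C}^+=F(\sigma_{A,A})$, $\mathbf{C}^-=F(\sigma_{A,A}^{-1})$, $\mathbf{I}=F(\mathrm{id}_I)$, $\boldsymbol{\theta}^+=F(\theta_A)$ and $\boldsymbol{\theta}^-=F(\theta_A^{-1})$.
   Context: Ribbon category: a (strict) braided monoidal category with braid $\sigma_{X,Y}:X\otimes Y\to Y\otimes X$, natural twist isomorphism $\theta$ with $\theta_{X\otimes Y}=\sigma_{X,Y};(\theta_Y\otimes\theta_X);\sigma_{Y,X}$, every object $X$ having a chosen left dual $X^*$ with unit $\eta_X:I\to X\otimes X^*$, counit $\varepsilon_X:X^*\otimes X\to I$ satisfying the snake equations, and $(\theta_X)^*=\theta_{X^*}$; composition $f;g$ is diagrammatic. Trace: $\mathrm{Tr}^X_{U,V}(f)=(U\otimes\eta_X);(f\otimes X^* );(V\otimes(\sigma_{X,X^*};(X^*\otimes\theta_X);\varepsilon_X))$ for $f:U\otimes X\to V\otimes X$. A reflexive object is an object $A$ with an isomorphism $\varphi:A\otimes A^*\to A$. Define $\mathbf{app}:=(\varphi^{-1}\otimes A);(A\otimes\varepsilon_A):A\otimes A\to A$; $\mathbf{lam}:=(A\otimes\eta_A);(A\otimes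 A\otimes\theta_{A^*}^{-1});(A\otimes\sigma^{-1}_{A^*,A});(\varphi\otimes A):A\to A\otimes A$; $\mathbf{app}_0=\mathrm{id}_A$, $\mathbf{app}_{n+1}=(\mathbf{app}\otimes A^{\otimes n});\mathbf{app}_n$; $\mathbf{lam}_0=\mathrm{id}_A$, $\mathbf{lam}_{m+1}=\mathbf{lam}_m;(\mathbf{lam}\otimes A^{\otimes m})$; for $f:A^{\otimes m}\to A^{\otimes n}$, $F(f):=\mathrm{Tr}^A_{I,A}(\mathbf{lam}_m;(\mathbf{lam}\otimes f);(A\otimes\mathbf{app}_n)):I\to A$. Applicative structures have left-associative application; write $a\circ b:=\mathbf{B}\,a\,b$. An extensional $\mathbf{BC^{\pm}I}$-algebra is an applicative structure with elements $\mathbf{B},\mathbf{C}^+,\mathbf{C}^-,\mathbf{I}$ such that for all $a,b,c$ (each $\star$ ranging independently over $\{+,-\}$; $\pm/\mp$ linked and required for both choices): $\mathbf{B}\,a\,b\,c=a\,(b\,c)$; $\mathbf{C}^\star\,a\,b\,c=a\,c\,b$; $\mathbf{I}\,a=a$; $\mathbf{C}^+\,a\,b=\mathbf{C}^-\,a\,b$; $\mathbf{B}\,\mathbf{I}=\mathbf{I}$; $\mathbf{C}^\star\,\mathbf{B}\,\mathbf{I}=\mathbf{B}\,\mathbf{I}$; $(\mathbf{C}^\star\,\mathbf{B}\,\mathbf{B})\circ(\mathbf{B}\circ\mathbf{B})=(\mathbf{B}\,\mathbf{B})\circ\mathbf{B}$; $\mathbf{C}^\pm\circ\mathbf{C}^\mp=\mathbf{B}\,(\mathbf{B}\,\mathbf{I})$;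 $(\mathbf{C}^\star\,\mathbf{B}\,\mathbf{C}^\pm)\circ(\mathbf{B}\circ\mathbf{B})=(\mathbf{B}\,\mathbf{C}^\pm)\circ(\mathbf{B}\circ\mathbf{B})$; $(\mathbf{B}\,\mathbf{C}^\pm)\circ(\mathbf{C}^\pm\circ(\mathbf{B}\,\mathbf{C}^\pm))=\mathbf{C}^\pm\circ((\mathbf{B}\,\mathbf{C}^\pm)\circ\mathbf{C}^\pm)$; $(\mathbf{B}\,\mathbf{B})\circ\mathbf{C}^\pm=\mathbf{C}^\pm\circ((\mathbf{B}\,\mathbf{C}^\pm)\circ\mathbf{B})$. It is balanced with elements $\boldsymbol{\theta}^+,\boldsymbol{\theta}^-$ if for all $a$: $(\mathbf{B}\,\boldsymbol{\theta}^\pm)\circ\mathbf{B}=(\mathbf{C}^\star\,\mathbf{B}\,\boldsymbol{\theta}^\pm)\circ\mathbf{B}$; $\boldsymbol{\theta}^\pm\circ\boldsymbol{\theta}^\mp=\mathbf{B}\,\mathbf{I}$; $\mathbf{C}^\star\,\boldsymbol{\theta}^\star\,a=\mathbf{C}^\star\,\mathbf{I}\,a$; $\mathbf{B}\circ\boldsymbol{\theta}^\pm=\boldsymbol{\theta}^\pm\circ(\mathbf{C}^\pm\circ(\boldsymbol{\theta}^\pm\circ(\mathbf{C}^\pm\circ\mathbf{B})))$. *)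

theory Defs
  imports Main
begin

section \<open>Strict ribbon categories\<close>

text \<open>
  Categories are given by carrier sets of objects and of arrows; all operations are constrained
  on these carriers only. Composition \<open>f ;; g\<close> is diagrammatic (first \<open>f\<close>, then \<open>g\<close>).
  The tensor product is written \<open>\<odot>\<close> on objects and \<open>\<otimes>\<close> on arrows.
\<close>

record ('o, 'm) cat =
  Obj  :: "'o set"
  Arr  :: "'m set"
  Dom  :: "'m \<Rightarrow> 'o"
  Cod  :: "'m \<Rightarrow> 'o"
  Id   :: "'o \<Rightarrow> 'm"  ("\<one>\<index>")
  Comp :: "'m \<Rightarrow> 'm \<Rightarrow> 'm"  (infixl ";;\<index>" 60)

record ('o, 'm) monoidal_cat = "('o, 'm) cat" +
  Unit    :: "'o"
  TensObj :: "'o \<Rightarrow> 'o \<Rightarrow> 'o"  (infixr "\<odot>\<index>" 75)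
  Tens    :: "'m \<Rightarrow> 'm \<Rightarrow> 'm"  (infixr "\<otimes>\<index>" 70)

record ('o, 'm) ribbon_cat = "('o, 'm) monoidal_cat" +
  Braid :: "'o \<Rightarrow> 'o \<Rightarrow> 'm"  ("\<sigma>\<index>")
  Twist :: "'o \<Rightarrow> 'm"  ("\<theta>\<index>")
  Dual  :: "'o \<Rightarrow> 'o"
  Coev  :: "'o \<Rightarrow> 'm"  ("\<eta>\<index>")
  Ev    :: "'o \<Rightarrow> 'm"  ("\<epsilon>\<index>")

definition Hom :: "('o, 'm, 'r) cat_scheme \<Rightarrow> 'o \<Rightarrow> 'o \<Rightarrow> 'm set" where
  "Hom C X Y = {f \<in> Arr C. Dom C f = X \<and> Cod C f = Y}"

definition inverse_arrows :: "('o, 'm, 'r) cat_scheme \<Rightarrow> 'm \<Rightarrow> 'm \<Rightarrow> bool" where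
  "inverse_arrows C f g \<longleftrightarrow>
     f \<in> Arr C \<and> g \<in> Hom C (Cod C f) (Dom C f) \<and>
     f ;;\<^bsub>C\<^esub> g = \<one>\<^bsub>C\<^esub> (Dom C f) \<and> g ;;\<^bsub>C\<^esub> f = \<one>\<^bsub>C\<^esub> (Cod C f)"

definition is_iso :: "('o, 'm, 'r) cat_scheme \<Rightarrow> 'm \<Rightarrow> bool" where
  "is_iso C f \<longleftrightarrow> (\<exists>g. inverse_arrows C f g)"

definition inv_arrow :: "('o, 'm, 'r) cat_scheme \<Rightarrow> 'm \<Rightarrow> 'm" where
  "inv_arrow C f = (THE g. inverse_arrows C f g)"

definition dual_arrow :: "('o, 'm, 'r) ribbon_cat_scheme \<Rightarrow> 'm \<Rightarrow> 'm" where
  "dual_arrow C f =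
     (let X = Dom C f; Y = Cod C f; X' = Dual C X; Y' = Dual C Y in
       (\<one>\<^bsub>C\<^esub> Y' \<otimes>\<^bsub>C\<^esub> \<eta>\<^bsub>C\<^esub> X) ;;\<^bsub>C\<^esub>
       (\<one>\<^bsub>C\<^esub> Y' \<otimes>\<^bsub>C\<^esub> f \<otimes>\<^bsub>C\<^esub> \<one>\<^bsub>C\<^esub> X') ;;\<^bsub>C\<^esub>
       (\<epsilon>\<^bsub>C\<^esub> Y \<otimes>\<^bsub>C\<^esub> \<one>\<^bsub>C\<^esub> X'))"

locale category =
  fixes C :: "('o, 'm, 'r) cat_scheme" (structure)
  assumes dom_closed: "f \<in> Arr C \<Longrightarrow> Dom C f \<in> Obj C"
    and cod_closed: "f \<in> Arr C \<Longrightarrow> Cod C f \<in> Obj C"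
    and id_hom: "X \<in> Obj C \<Longrightarrow> \<one> X \<in> Hom C X X"
    and comp_hom: "\<lbrakk>f \<in> Hom C X Y; g \<in> Hom C Y Z\<rbrakk> \<Longrightarrow> f ;; g \<in> Hom C X Z"
    and comp_id_left: "f \<in> Hom C X Y \<Longrightarrow> \<one> X ;; f = f"
    and comp_id_right: "f \<in> Hom C X Y \<Longrightarrow> f ;; \<one> Y = f"
    and comp_assoc: "\<lbrakk>f \<in> Hom C W X; g \<in> Hom C X Y; h \<in> Hom C Y Z\<rbrakk>
          \<Longrightarrow> (f ;; g) ;; h = f ;; (g ;; h)"

locale strict_monoidal_category = category C
  for C :: "('o, 'm, 'r) monoidal_cat_scheme" (structure) +
  assumes unit_obj: "Unit C \<in> Obj C"
    and tens_obj: "\<lbrakk>X \<in> Obj C; Y \<in> Obj C\<rbrakk> \<Longrightarrow> X \<odot> Y \<in> Obj C"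
    and tens_hom: "\<lbrakk>f \<in> Hom C X X'; g \<in> Hom C Y Y'\<rbrakk> \<Longrightarrow> f \<otimes> g \<in> Hom C (X \<odot> Y) (X' \<odot> Y')"
    and tens_id: "\<lbrakk>X \<in> Obj C; Y \<in> Obj C\<rbrakk> \<Longrightarrow> \<one> X \<otimes> \<one> Y = \<one> (X \<odot> Y)"
    and interchange: "\<lbrakk>f \<in> Hom C X Y; f' \<in> Hom C Y Z; g \<in> Hom C X' Y'; g' \<in> Hom C Y' Z'\<rbrakk>
          \<Longrightarrow> (f ;; f') \<otimes> (g ;; g') = (f \<otimes> g) ;; (f' \<otimes> g')"
    and tens_obj_assoc: "\<lbrakk>X \<in> Obj C; Y \<in> Obj C; Z \<in> Obj C\<rbrakk> \<Longrightarrow> (X \<odot> Y) \<odot> Z = X \<odot> (Y \<odot> Z)"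
    and tens_obj_unit_left: "X \<in> Obj C \<Longrightarrow> Unit C \<odot> X = X"
    and tens_obj_unit_right: "X \<in> Obj C \<Longrightarrow> X \<odot> Unit C = X"
    and tens_assoc: "\<lbrakk>f \<in> Arr C; g \<in> Arr C; h \<in> Arr C\<rbrakk> \<Longrightarrow> (f \<otimes> g) \<otimes> h = f \<otimes> (g \<otimes> h)"
    and tens_unit_left: "f \<in> Arr C \<Longrightarrow> \<one> (Unit C) \<otimes> f = f"
    and tens_unit_right: "f \<in> Arr C \<Longrightarrow> f \<otimes> \<one> (Unit C) = f"

locale strict_ribbon_category = strict_monoidal_category C
  for C :: "('o, 'm, 'r) ribbon_cat_scheme" (structure) +
  assumes braid_hom: "\<lbrakk>X \<in> Obj C; Y \<in> Obj C\<rbrakk> \<Longrightarrow> \<sigma> X Y \<in> Hom C (X \<odot> Y) (Y \<odot> X)"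
    and braid_iso: "\<lbrakk>X \<in> Obj C; Y \<in> Obj C\<rbrakk> \<Longrightarrow> is_iso C (\<sigma> X Y)"
    and braid_natural: "\<lbrakk>f \<in> Hom C X X'; g \<in> Hom C Y Y'\<rbrakk>
          \<Longrightarrow> (f \<otimes> g) ;; \<sigma> X' Y' = \<sigma> X Y ;; (g \<otimes> f)"
    and braid_tens_right: "\<lbrakk>X \<in> Obj C; Y \<in> Obj C; Z \<in> Obj C\<rbrakk>
          \<Longrightarrow> \<sigma> X (Y \<odot> Z) = (\<sigma> X Y \<otimes> \<one> Z) ;; (\<one> Y \<otimes> \<sigma> X Z)"
    and braid_tens_left: "\<lbrakk>X \<in> Obj C; Y \<in> Obj C; Z \<in> Obj C\<rbrakk>
          \<Longrightarrow> \<sigma> (X \<odot> Y) Z = (\<one> X \<otimes> \<sigma> Y Z) ;; (\<sigma> X Z \<otimes> \<one> Y)"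
    and twist_hom: "X \<in> Obj C \<Longrightarrow> \<theta> X \<in> Hom C X X"
    and twist_iso: "X \<in> Obj C \<Longrightarrow> is_iso C (\<theta> X)"
    and twist_natural: "f \<in> Hom C X Y \<Longrightarrow> f ;; \<theta> Y = \<theta> X ;; f"
    and twist_tens: "\<lbrakk>X \<in> Obj C; Y \<in> Obj C\<rbrakk> \<Longrightarrow> \<theta> (X \<odot> Y) = \<sigma> X Y ;; (\<theta> Y \<otimes> \<theta> X) ;; \<sigma> Y X"
    and dual_obj: "X \<in> Obj C \<Longrightarrow> Dual C X \<in> Obj C"
    and coev_hom: "X \<in> Obj C \<Longrightarrow> \<eta> X \<in> Hom C (Unit C) (X \<odot> Dual C X)"
    and ev_hom: "X \<in> Obj C \<Longrightarrow> \<epsilon> X \<in> Hom C (Dual C X \<odot> X) (Unit C)"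
    and snake: "X \<in> Obj C \<Longrightarrow> (\<eta> X \<otimes> \<one> X) ;; (\<one> X \<otimes> \<epsilon> X) = \<one> X"
    and snake_dual: "X \<in> Obj C \<Longrightarrow>
          (\<one> (Dual C X) \<otimes> \<eta> X) ;; (\<epsilon> X \<otimes> \<one> (Dual C X)) = \<one> (Dual C X)"
    and twist_dual: "X \<in> Obj C \<Longrightarrow> dual_arrow C (\<theta> X) = \<theta> (Dual C X)"

definition trace :: "('o, 'm, 'r) ribbon_cat_scheme \<Rightarrow> 'o \<Rightarrow> 'o \<Rightarrow> 'o \<Rightarrow> 'm \<Rightarrow> 'm" where
  "trace C X U V f =
     (let X' = Dual C X in
       (\<one>\<^bsub>C\<^esub> U \<otimes>\<^bsub>C\<^esub> \<eta>\<^bsub>C\<^esub> X) ;;\<^bsub>C\<^esub>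
       (f \<otimes>\<^bsub>C\<^esub> \<one>\<^bsub>C\<^esub> X') ;;\<^bsub>C\<^esub>
       (\<one>\<^bsub>C\<^esub> V \<otimes>\<^bsub>C\<^esub>
         (\<sigma>\<^bsub>C\<^esub> X X' ;;\<^bsub>C\<^esub> (\<one>\<^bsub>C\<^esub> X' \<otimes>\<^bsub>C\<^esub> \<theta>\<^bsub>C\<^esub> X) ;;\<^bsub>C\<^esub> \<epsilon>\<^bsub>C\<^esub> X)))"


section \<open>Reflexive objects\<close>

locale reflexive_object = strict_ribbon_category C
  for C :: "('o, 'm, 'r) ribbon_cat_scheme" (structure) +
  fixes A :: 'o and \<phi> :: 'm
  assumes refl_obj: "A \<in> Obj C"
    and refl_hom: "\<phi> \<in> Hom C (A \<odot> Dual C A) A"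
    and refl_iso: "is_iso C \<phi>"

primrec tens_pow :: "('o, 'm, 'r) monoidal_cat_scheme \<Rightarrow> 'o \<Rightarrow> nat \<Rightarrow> 'o" where
  "tens_pow C A 0 = Unit C"
| "tens_pow C A (Suc n) = A \<odot>\<^bsub>C\<^esub> tens_pow C A n"

definition app :: "('o, 'm, 'r) ribbon_cat_scheme \<Rightarrow> 'o \<Rightarrow> 'm \<Rightarrow> 'm" where
  "app C A \<phi> = (inv_arrow C \<phi> \<otimes>\<^bsub>C\<^esub> \<one>\<^bsub>C\<^esub> A) ;;\<^bsub>C\<^esub> (\<one>\<^bsub>C\<^esub> A \<otimes>\<^bsub>C\<^esub> \<epsilon>\<^bsub>C\<^esub> A)"

definition lam :: "('o, 'm, 'r) ribbon_cat_scheme \<Rightarrow> 'o \<Rightarrow> 'm \<Rightarrow> 'm" where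
  "lam C A \<phi> =
     (\<one>\<^bsub>C\<^esub> A \<otimes>\<^bsub>C\<^esub> \<eta>\<^bsub>C\<^esub> A) ;;\<^bsub>C\<^esub>
     (\<one>\<^bsub>C\<^esub> A \<otimes>\<^bsub>C\<^esub> \<one>\<^bsub>C\<^esub> A \<otimes>\<^bsub>C\<^esub> inv_arrow C (\<theta>\<^bsub>C\<^esub> (Dual C A))) ;;\<^bsub>C\<^esub>
     (\<one>\<^bsub>C\<^esub> A \<otimes>\<^bsub>C\<^esub> inv_arrow C (\<sigma>\<^bsub>C\<^esub> (Dual C A) A)) ;;\<^bsub>C\<^esub>
     (\<phi> \<otimes>\<^bsub>C\<^esub> \<one>\<^bsub>C\<^esub> A)"

primrec app_n :: "('o, 'm, 'r) ribbon_cat_scheme \<Rightarrow> 'o \<Rightarrow> 'm \<Rightarrow> nat \<Rightarrow> 'm" where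
  "app_n C A \<phi> 0 = \<one>\<^bsub>C\<^esub> A"
| "app_n C A \<phi> (Suc n) = (app C A \<phi> \<otimes>\<^bsub>C\<^esub> \<one>\<^bsub>C\<^esub> (tens_pow C A n)) ;;\<^bsub>C\<^esub> app_n C A \<phi> n"

primrec lam_n :: "('o, 'm, 'r) ribbon_cat_scheme \<Rightarrow> 'o \<Rightarrow> 'm \<Rightarrow> nat \<Rightarrow> 'm" where
  "lam_n C A \<phi> 0 = \<one>\<^bsub>C\<^esub> A"
| "lam_n C A \<phi> (Suc m) = lam_n C A \<phi> m ;;\<^bsub>C\<^esub> (lam C A \<phi> \<otimes>\<^bsub>C\<^esub> \<one>\<^bsub>C\<^esub> (tens_pow C A m))"

text \<open>
  \<open>close_arrow C A \<phi> m n f\<close> is the closed term \<open>F(f)\<close> of \<open>f\<close> from the \<open>m\<close>-th to the \<open>n\<close>-th tensor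
  power of \<open>A\<close>. The exponents are arguments since different exponents may give the same object.
\<close>

definition close_arrow ::
  "('o, 'm, 'r) ribbon_cat_scheme \<Rightarrow> 'o \<Rightarrow> 'm \<Rightarrow> nat \<Rightarrow> nat \<Rightarrow> 'm \<Rightarrow> 'm" where
  "close_arrow C A \<phi> m n f =
     trace C A (Unit C) A
       (lam_n C A \<phi> m ;;\<^bsub>C\<^esub> (lam C A \<phi> \<otimes>\<^bsub>C\<^esub> f) ;;\<^bsub>C\<^esub> (\<one>\<^bsub>C\<^esub> A \<otimes>\<^bsub>C\<^esub> app_n C A \<phi> n))"

definition global_app :: "('o, 'm, 'r) ribbon_cat_scheme \<Rightarrow> 'o \<Rightarrow> 'm \<Rightarrow> 'm \<Rightarrow> 'm \<Rightarrow> 'm" where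
  "global_app C A \<phi> a b = (a \<otimes>\<^bsub>C\<^esub> b) ;;\<^bsub>C\<^esub> app C A \<phi>"


section \<open>Balanced extensional braided algebras\<close>

locale applicative_structure =
  fixes S :: "'a set" and ap :: "'a \<Rightarrow> 'a \<Rightarrow> 'a"  (infixl "\<cdot>" 70)
  assumes ap_closed: "\<lbrakk>a \<in> S; b \<in> S\<rbrakk> \<Longrightarrow> a \<cdot> b \<in> S"

locale applicative_structure_B = applicative_structure S ap
  for S :: "'a set" and ap :: "'a \<Rightarrow> 'a \<Rightarrow> 'a"  (infixl "\<cdot>" 70) +
  fixes B :: 'a
  assumes B_closed: "B \<in> S"
begin

abbreviation bcomp :: "'a \<Rightarrow> 'a \<Rightarrow> 'a"  (infixr "\<circ>\<^sub>B" 65) where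
  "a \<circ>\<^sub>B b \<equiv> B \<cdot> a \<cdot> b"

end

text \<open>
  In the axioms below, variables ranging over \<open>{Cp, Cm}\<close> render independent signs; a pair ranging
  over \<open>{(Cp, Cm), (Cm, Cp)}\<close>, or over \<open>{(Tp, Cp), (Tm, Cm)}\<close>, renders linked signs.
\<close>

locale extensional_BCI_algebra = applicative_structure_B S ap B
  for S :: "'a set" and ap :: "'a \<Rightarrow> 'a \<Rightarrow> 'a"  (infixl "\<cdot>" 70) and B :: 'a +
  fixes Cp Cm I :: 'a
  assumes Cp_closed: "Cp \<in> S" and Cm_closed: "Cm \<in> S" and I_closed: "I \<in> S"
    and B_eq: "\<lbrakk>a \<in> S; b \<in> S; c \<in> S\<rbrakk> \<Longrightarrow> B \<cdot> a \<cdot> b \<cdot> c = a \<cdot> (b \<cdot> c)"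
    and C_eq: "\<lbrakk>D \<in> {Cp, Cm}; a \<in> S; b \<in> S; c \<in> S\<rbrakk> \<Longrightarrow> D \<cdot> a \<cdot> b \<cdot> c = a \<cdot> c \<cdot> b"
    and I_eq: "a \<in> S \<Longrightarrow> I \<cdot> a = a"
    and Cp_Cm: "\<lbrakk>a \<in> S; b \<in> S\<rbrakk> \<Longrightarrow> Cp \<cdot> a \<cdot> b = Cm \<cdot> a \<cdot> b"
    and B_I: "B \<cdot> I = I"
    and C_B_I: "D \<in> {Cp, Cm} \<Longrightarrow> D \<cdot> B \<cdot> I = B \<cdot> I"
    and C_B_B: "D \<in> {Cp, Cm} \<Longrightarrow> (D \<cdot> B \<cdot> B) \<circ>\<^sub>B (B \<circ>\<^sub>B B) = (B \<cdot> B) \<circ>\<^sub>B B"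
    and C_inverse: "(D, D') \<in> {(Cp, Cm), (Cm, Cp)} \<Longrightarrow> D \<circ>\<^sub>B D' = B \<cdot> (B \<cdot> I)"
    and C_B_C: "\<lbrakk>D \<in> {Cp, Cm}; E \<in> {Cp, Cm}\<rbrakk> \<Longrightarrow>
          (D \<cdot> B \<cdot> E) \<circ>\<^sub>B (B \<circ>\<^sub>B B) = (B \<cdot> E) \<circ>\<^sub>B (B \<circ>\<^sub>B B)"
    and C_yang_baxter: "D \<in> {Cp, Cm} \<Longrightarrow>
          (B \<cdot> D) \<circ>\<^sub>B (D \<circ>\<^sub>B (B \<cdot> D)) = D \<circ>\<^sub>B ((B \<cdot> D) \<circ>\<^sub>B D)"
    and B_B_C: "D \<in> {Cp, Cm} \<Longrightarrow> (B \<cdot> B) \<circ>\<^sub>B D = D \<circ>\<^sub>B ((B \<cdot> D) \<circ>\<^sub>B B)"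

locale balanced_extensional_BCI_algebra = extensional_BCI_algebra S ap B Cp Cm I
  for S :: "'a set" and ap :: "'a \<Rightarrow> 'a \<Rightarrow> 'a"  (infixl "\<cdot>" 70) and B Cp Cm I :: 'a +
  fixes Tp Tm :: 'a
  assumes Tp_closed: "Tp \<in> S" and Tm_closed: "Tm \<in> S"
    and B_T: "\<lbrakk>T \<in> {Tp, Tm}; D \<in> {Cp, Cm}\<rbrakk> \<Longrightarrow> (B \<cdot> T) \<circ>\<^sub>B B = (D \<cdot> B \<cdot> T) \<circ>\<^sub>B B"
    and T_inverse: "(T, T') \<in> {(Tp, Tm), (Tm, Tp)} \<Longrightarrow> T \<circ>\<^sub>B T' = B \<cdot> I"
    and C_T: "\<lbrakk>D \<in> {Cp, Cm}; T \<in> {Tp, Tm}; E \<in> {Cp, Cm}; a \<in> S\<rbrakk> \<Longrightarrow> D \<cdot> T \<cdot> a = E \<cdot> I \<cdot> a"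
    and B_comp_T: "(T, D) \<in> {(Tp, Cp), (Tm, Cm)} \<Longrightarrow>
          B \<circ>\<^sub>B T = T \<circ>\<^sub>B (D \<circ>\<^sub>B (T \<circ>\<^sub>B (D \<circ>\<^sub>B B)))"

end

theory Submission
  imports Defs
begin

text \<open>
  Application of arrows into \<open>A\<close>, \<open>u \<bullet> v = (u \<otimes> v) ;; app\<close>, makes sense for arbitrary domains, and
  \<open>u \<mapsto> u \<bullet> \<one> A\<close> is injective by a snake equation. The trace of \<open>lam\<close> cancels against \<open>app\<close>
  because \<open>lam\<close> creates \<open>A\<close> together with a second, right-handed coevaluation that forms a snake
  with the twisted evaluation of the trace. Hence \<open>F f\<close> is determined by
  \<open>F f \<bullet> \<one> A \<bullet> \<dots> \<bullet> \<one> A = (\<one> A \<otimes> f) ;; app\<^sub>n\<close>, which gives rewrite rules such as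
  \<open>B \<bullet> u \<bullet> v \<bullet> w = u \<bullet> (v \<bullet> w)\<close> and \<open>C \<bullet> u \<bullet> v \<bullet> w = (\<one> \<otimes> \<sigma>) ;; (u \<bullet> w \<bullet> v)\<close>. Applied to enough identities,
  each axiom becomes an equation between braids: a hexagon, the Yang-Baxter equation, or the balance
  condition for the twist.
\<close>

section \<open>Calculus in strict monoidal categories\<close>

context category
begin

lemma hom_iff: "f \<in> Hom C X Y \<longleftrightarrow> f \<in> Arr C \<and> Dom C f = X \<and> Cod C f = Y"
  by (simp add: Hom_def)

lemmas obj_closed [simp] = dom_closed cod_closed

lemma id_typing [simp]:
  assumes "X \<in> Obj C"
  shows "\<one> X \<in> Arr C" "Dom C (\<one> X) = X" "Cod C (\<one> X) = X"
  using id_hom[OF assms] by (simp_all add: hom_iff)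

lemma comp_typing [simp]:
  assumes "f \<in> Arr C" "g \<in> Arr C" "Cod C f = Dom C g"
  shows "f ;; g \<in> Arr C" "Dom C (f ;; g) = Dom C f" "Cod C (f ;; g) = Cod C g"
  using comp_hom[of f "Dom C f" "Cod C f" g "Cod C g"] assms by (simp_all add: hom_iff)

lemma comp_id [simp]:
  "\<lbrakk>f \<in> Arr C; Dom C f = X\<rbrakk> \<Longrightarrow> \<one> X ;; f = f"
  "\<lbrakk>f \<in> Arr C; Cod C f = X\<rbrakk> \<Longrightarrow> f ;; \<one> X = f"
  using comp_id_left comp_id_right by (auto simp: hom_iff)

lemma comp_assoc_arr:
  "\<lbrakk>f \<in> Arr C; g \<in> Arr C; h \<in> Arr C; Cod C f = Dom C g; Cod C g = Dom C h\<rbrakk>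
    \<Longrightarrow> (f ;; g) ;; h = f ;; (g ;; h)"
  using comp_assoc by (simp add: hom_iff)

lemma inverse_arrows_unique:
  assumes "inverse_arrows C f g" "inverse_arrows C f h"
  shows "g = h"
proof -
  have "g = g ;; (f ;; h)"
    using assms by (simp add: inverse_arrows_def hom_iff)
  also have "\<dots> = (g ;; f) ;; h"
    using assms by (subst comp_assoc_arr) (auto simp: inverse_arrows_def hom_iff)
  also have "\<dots> = h"
    using assms by (simp add: inverse_arrows_def hom_iff)
  finally show ?thesis .
qed

lemma inv_arrow_eq: "inverse_arrows C f g \<Longrightarrow> inv_arrow C f = g"
  unfolding inv_arrow_def by (blast intro: inverse_arrows_unique)

lemma inverse_arrows_inv_arrow: "is_iso C f \<Longrightarrow> inverse_arrows C f (inv_arrow C f)"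
  unfolding is_iso_def using inv_arrow_eq by metis

lemma inv_arrow_simps:
  assumes "is_iso C f"
  shows "f \<in> Arr C" "inv_arrow C f \<in> Arr C"
    "Dom C (inv_arrow C f) = Cod C f" "Cod C (inv_arrow C f) = Dom C f"
    "f ;; inv_arrow C f = \<one> (Dom C f)" "inv_arrow C f ;; f = \<one> (Cod C f)"
  using inverse_arrows_inv_arrow[OF assms] by (auto simp: inverse_arrows_def hom_iff)

text \<open>Cancel one copy of \<open>f\<close> by its inverse. Braidings and twists at the unit
  object are shown trivial this way.\<close>

lemma idempotent_iso:
  assumes "is_iso C f" "Cod C f = Dom C f" "f ;; f = f"
  shows "f = \<one> (Dom C f)"
proof -
  note [simp] = inv_arrow_simps[OF assms(1)]
  have "f = f ;; (f ;; inv_arrow C f)"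
    using assms(2) by simp
  also have "\<dots> = (f ;; f) ;; inv_arrow C f"
    using assms(2) by (subst comp_assoc_arr) simp_all
  also have "\<dots> = \<one> (Dom C f)"
    by (simp add: assms(3))
  finally show ?thesis .
qed

end

context strict_monoidal_category
begin

lemma unit_obj_simp [simp]: "Unit C \<in> Obj C"
  by (rule unit_obj)

lemma tens_obj_simps [simp]:
  "\<lbrakk>X \<in> Obj C; Y \<in> Obj C\<rbrakk> \<Longrightarrow> X \<odot> Y \<in> Obj C"
  "\<lbrakk>X \<in> Obj C; Y \<in> Obj C; Z \<in> Obj C\<rbrakk> \<Longrightarrow> (X \<odot> Y) \<odot> Z = X \<odot> (Y \<odot> Z)"
  "X \<in> Obj C \<Longrightarrow> Unit C \<odot> X = X"
  "X \<in> Obj C \<Longrightarrow> X \<odot> Unit C = X"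
  by (simp_all add: tens_obj tens_obj_assoc tens_obj_unit_left tens_obj_unit_right)

lemma tens_typing [simp]:
  assumes "f \<in> Arr C" "g \<in> Arr C"
  shows "f \<otimes> g \<in> Arr C" "Dom C (f \<otimes> g) = Dom C f \<odot> Dom C g"
    "Cod C (f \<otimes> g) = Cod C f \<odot> Cod C g"
  using tens_hom[of f "Dom C f" "Cod C f" g "Dom C g" "Cod C g"] assms by (simp_all add: hom_iff)

lemmas tens_simps [simp] = tens_assoc tens_unit_left tens_unit_right

text \<open>The reverse of the locale axiom \<open>tens_id\<close>. Splitting identities exposes the
  tensor factors on which interchange acts; \<open>comp_id_tens\<close> then absorbs the split
  identities that remain.\<close>

lemma id_tens: "\<lbrakk>X \<in> Obj C; Y \<in> Obj C\<rbrakk> \<Longrightarrow> \<one> (X \<odot> Y) = \<one> X \<otimes> \<one> Y"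
  by (simp add: tens_id)

lemma comp_id_tens:
  "\<lbrakk>f \<in> Arr C; X \<in> Obj C; Y \<in> Obj C; Cod C f = X \<odot> Y\<rbrakk> \<Longrightarrow> f ;; (\<one> X \<otimes> \<one> Y) = f"
  "\<lbrakk>f \<in> Arr C; X \<in> Obj C; Y \<in> Obj C; Dom C f = X \<odot> Y\<rbrakk> \<Longrightarrow> (\<one> X \<otimes> \<one> Y) ;; f = f"
  "\<lbrakk>f \<in> Arr C; X \<in> Obj C; Y \<in> Obj C; Z \<in> Obj C; Dom C f = X \<odot> Y \<odot> Z\<rbrakk>
    \<Longrightarrow> (\<one> X \<otimes> \<one> Y \<otimes> \<one> Z) ;; f = f"
  by (simp_all add: tens_id)

lemma comp_tens:
  "\<lbrakk>f \<in> Arr C; f' \<in> Arr C; g \<in> Arr C; g' \<in> Arr C; Cod C f = Dom C f'; Cod C g = Dom C g'\<rbrakk>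
    \<Longrightarrow> (f \<otimes> g) ;; (f' \<otimes> g') = (f ;; f') \<otimes> (g ;; g')"
  using interchange by (simp add: hom_iff)

lemma comp_tens_assoc:
  "\<lbrakk>f \<in> Arr C; f' \<in> Arr C; g \<in> Arr C; g' \<in> Arr C; Cod C f = Dom C f'; Cod C g = Dom C g';
    h \<in> Arr C; Dom C h = Cod C f' \<odot> Cod C g'\<rbrakk>
    \<Longrightarrow> (f \<otimes> g) ;; ((f' \<otimes> g') ;; h) = ((f ;; f') \<otimes> (g ;; g')) ;; h"
  by (simp add: comp_tens comp_assoc_arr[symmetric])

lemma swap_tens:
  "\<lbrakk>f \<in> Arr C; g \<in> Arr C\<rbrakk>
    \<Longrightarrow> (\<one> (Dom C f) \<otimes> g) ;; (f \<otimes> \<one> (Cod C g)) = (f \<otimes> \<one> (Dom C g)) ;; (\<one> (Cod C f) \<otimes> g)"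
  by (simp add: comp_tens)

lemma whisker:
  assumes "f \<in> Arr C" "g \<in> Arr C" "Cod C f = Dom C g" "W \<in> Obj C"
  shows "(f ;; g) \<otimes> \<one> W = (f \<otimes> \<one> W) ;; (g \<otimes> \<one> W)"
    "\<one> W \<otimes> (f ;; g) = (\<one> W \<otimes> f) ;; (\<one> W \<otimes> g)"
  using assms by (simp_all add: comp_tens)

text \<open>A rewrite system that fuses a composite of tensors into one tensor of composites, also
  inside right-nested composites. \<open>whisker\<close> goes the opposite way.\<close>

lemmas merge = comp_tens comp_tens_assoc comp_assoc_arr id_tens

end

section \<open>Ribbon categories\<close>

context strict_ribbon_category
begin

lemma braid_typing [simp]:
  assumes "X \<in> Obj C" "Y \<in> Obj C"
  shows "\<sigma> X Y \<in> Arr C" "Dom C (\<sigma> X Y) = X \<odot> Y" "Cod C (\<sigma> X Y) = Y \<odot> X"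
  using braid_hom[OF assms] by (simp_all add: hom_iff)

lemma twist_typing [simp]:
  assumes "X \<in> Obj C"
  shows "\<theta> X \<in> Arr C" "Dom C (\<theta> X) = X" "Cod C (\<theta> X) = X"
  using twist_hom[OF assms] by (simp_all add: hom_iff)

lemma inv_braid_simps [simp]:
  assumes "X \<in> Obj C" "Y \<in> Obj C"
  shows "inv_arrow C (\<sigma> X Y) \<in> Arr C"
    "Dom C (inv_arrow C (\<sigma> X Y)) = Y \<odot> X" "Cod C (inv_arrow C (\<sigma> X Y)) = X \<odot> Y"
    "\<sigma> X Y ;; inv_arrow C (\<sigma> X Y) = \<one> (X \<odot> Y)"
    "inv_arrow C (\<sigma> X Y) ;; \<sigma> X Y = \<one> (Y \<odot> X)"
  using inv_arrow_simps[OF braid_iso[OF assms]] assms by simp_all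

lemma inv_twist_simps [simp]:
  assumes "X \<in> Obj C"
  shows "inv_arrow C (\<theta> X) \<in> Arr C"
    "Dom C (inv_arrow C (\<theta> X)) = X" "Cod C (inv_arrow C (\<theta> X)) = X"
    "\<theta> X ;; inv_arrow C (\<theta> X) = \<one> X"
    "inv_arrow C (\<theta> X) ;; \<theta> X = \<one> X"
  using inv_arrow_simps[OF twist_iso[OF assms]] assms by simp_all

lemma dual_typing [simp]:
  assumes "X \<in> Obj C"
  shows "Dual C X \<in> Obj C"
    "\<eta> X \<in> Arr C" "Dom C (\<eta> X) = Unit C" "Cod C (\<eta> X) = X \<odot> Dual C X"
    "\<epsilon> X \<in> Arr C" "Dom C (\<epsilon> X) = Dual C X \<odot> X" "Cod C (\<epsilon> X) = Unit C"
  using dual_obj[OF assms] coev_hom[OF assms] ev_hom[OF assms] by (simp_all add: hom_iff)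

lemma braid_natural_arr:
  "\<lbrakk>f \<in> Arr C; g \<in> Arr C\<rbrakk>
    \<Longrightarrow> (f \<otimes> g) ;; \<sigma> (Cod C f) (Cod C g) = \<sigma> (Dom C f) (Dom C g) ;; (g \<otimes> f)"
  using braid_natural by (simp add: hom_iff)

text \<open>With all the split factors equal to the unit object, a hexagon says that the braid is
  idempotent.\<close>

lemma braid_unit [simp]:
  assumes "X \<in> Obj C"
  shows "\<sigma> X (Unit C) = \<one> X" "\<sigma> (Unit C) X = \<one> X"
proof -
  have "\<sigma> X (Unit C) ;; \<sigma> X (Unit C) = \<sigma> X (Unit C)"
    using braid_tens_right[of X "Unit C" "Unit C"] assms by simp
  then show "\<sigma> X (Unit C) = \<one> X"
    using idempotent_iso[OF braid_iso, of X "Unit C"] assms by simp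
  have "\<sigma> (Unit C) X ;; \<sigma> (Unit C) X = \<sigma> (Unit C) X"
    using braid_tens_left[of "Unit C" "Unit C" X] assms by simp
  then show "\<sigma> (Unit C) X = \<one> X"
    using idempotent_iso[OF braid_iso, of "Unit C" X] assms by simp
qed

text \<open>At the unit object the braids in \<open>twist_tens\<close> are identities, and what is
  left is idempotence of the twist.\<close>

lemma twist_unit [simp]: "\<theta> (Unit C) = \<one> (Unit C)"
proof -
  have "\<theta> (Unit C) ;; \<theta> (Unit C) = \<theta> (Unit C)"
    using twist_tens[of "Unit C" "Unit C"] comp_tens[of "\<theta> (Unit C)" "\<one> (Unit C)" "\<one> (Unit C)" "\<theta> (Unit C)"]
    by simp
  then show ?thesis
    using idempotent_iso[OF twist_iso] by fastforce
qed

subsection \<open>Pivotal structure\<close>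

text \<open>
  The trace closes a strand on the right with \<open>ev'\<close>, which is \<open>wind\<close> of \<open>\<epsilon>\<close>. Winding moves a leg \<open>X\<close> of
  an arrow to \<open>Unit C\<close> from the right end to the left end.
\<close>

definition wind :: "'o \<Rightarrow> 'o \<Rightarrow> 'm \<Rightarrow> 'm" where
  "wind X Z j = \<sigma> X Z ;; ((\<one> Z \<otimes> \<theta> X) ;; j)"

lemma wind_typing [simp]:
  assumes "X \<in> Obj C" "Z \<in> Obj C" "j \<in> Arr C" "Dom C j = Z \<odot> X"
  shows "wind X Z j \<in> Arr C" "Dom C (wind X Z j) = X \<odot> Z" "Cod C (wind X Z j) = Cod C j"
  using assms by (simp_all add: wind_def)

text \<open>Naturality of the braid carries \<open>k\<close> and \<open>t\<close> across the
  crossing, and naturality of the twist lets \<open>k\<close> pass it. This is how the body of a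
  trace is moved around its loop.\<close>

lemma wind_natural:
  assumes "k \<in> Arr C" "Dom C k = X" "Cod C k = Y" "t \<in> Arr C" "Dom C t = Z" "Cod C t = W"
    "j \<in> Arr C" "Dom C j = W \<odot> Y"
  shows "(k \<otimes> t) ;; wind Y W j = wind X Z ((t \<otimes> k) ;; j)"
proof -
  have [simp]: "X \<in> Obj C" "Y \<in> Obj C" "Z \<in> Obj C" "W \<in> Obj C"
    using assms obj_closed by blast+
  note [simp] = assms
  have "(k \<otimes> t) ;; wind Y W j = ((k \<otimes> t) ;; \<sigma> Y W) ;; ((\<one> W \<otimes> \<theta> Y) ;; j)"
    by (simp add: wind_def comp_assoc_arr)
  also have "\<dots> = \<sigma> X Z ;; ((t \<otimes> (k ;; \<theta> Y)) ;; j)"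
    using braid_natural_arr[of k t] by (simp add: merge)
  also have "k ;; \<theta> Y = \<theta> X ;; k"
    using twist_natural[of k X Y] by (simp add: hom_iff)
  finally show ?thesis
    by (simp add: wind_def merge)
qed

text \<open>The right factor \<open>Y\<close> is wound first, then \<open>X\<close>. The double
  crossing of \<open>X\<close> and \<open>Y\<close> hidden in the twist of
  \<open>X \<odot> Y\<close> supplies exactly the crossings that two successive windings have beyond
  the braid of \<open>X \<odot> Y\<close> with \<open>W\<close>.\<close>

lemma wind_tens:
  assumes [simp]: "X \<in> Obj C" "Y \<in> Obj C" "W \<in> Obj C" "j \<in> Arr C" "Dom C j = W \<odot> X \<odot> Y"
  shows "wind (X \<odot> Y) W j = wind X (Y \<odot> W) (wind Y (W \<odot> X) j)"
proof -
  have t: "\<theta> (X \<odot> Y) = \<sigma> X Y ;; (\<sigma> Y X ;; (\<theta> X \<otimes> \<theta> Y))"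
    using braid_natural_arr[of "\<theta> Y" "\<theta> X"] by (simp add: twist_tens comp_assoc_arr)
  \<comment> \<open>The first half of the double crossing slides through the braid with
    \<open>W\<close>; hexagons then regroup the crossings into the two windings.\<close>
  have n: "\<sigma> (X \<odot> Y) W ;; (\<one> W \<otimes> \<sigma> X Y) = (\<sigma> X Y \<otimes> \<one> W) ;; \<sigma> (Y \<odot> X) W"
    using braid_natural_arr[of "\<sigma> X Y" "\<one> W"] by simp
  have "wind (X \<odot> Y) W j
      = (\<sigma> (X \<odot> Y) W ;; (\<one> W \<otimes> \<sigma> X Y)) ;; ((\<one> W \<otimes> \<sigma> Y X) ;; ((\<one> W \<otimes> \<theta> X \<otimes> \<theta> Y) ;; j))"
    by (simp add: wind_def t merge)
  also have "\<dots> = (\<sigma> X Y \<otimes> \<one> W) ;; ((\<one> Y \<otimes> \<sigma> X W) ;; ((\<sigma> Y W \<otimes> \<one> X) ;;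
      ((\<one> W \<otimes> \<sigma> Y X) ;; ((\<one> W \<otimes> \<theta> X \<otimes> \<theta> Y) ;; j))))"
    by (simp only: n) (simp add: braid_tens_left comp_assoc_arr)
  also have "\<dots> = \<sigma> X (Y \<odot> W) ;; (\<sigma> Y (W \<odot> X) ;; ((\<one> W \<otimes> \<theta> X \<otimes> \<theta> Y) ;; j))"
    by (simp add: braid_tens_right comp_assoc_arr)
  also have "(\<one> W \<otimes> \<theta> X \<otimes> \<theta> Y) ;; j = ((\<one> W \<otimes> \<theta> X) \<otimes> \<one> Y) ;; ((\<one> W \<otimes> \<one> X \<otimes> \<theta> Y) ;; j)"
    by (simp add: merge)
  also have "\<sigma> Y (W \<odot> X) ;; \<dots>
      = (\<sigma> Y (W \<odot> X) ;; ((\<one> W \<otimes> \<theta> X) \<otimes> \<one> Y)) ;; ((\<one> W \<otimes> \<one> X \<otimes> \<theta> Y) ;; j)"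
    by (simp add: comp_assoc_arr)
  also have "\<sigma> Y (W \<odot> X) ;; ((\<one> W \<otimes> \<theta> X) \<otimes> \<one> Y) = (\<one> Y \<otimes> \<one> W \<otimes> \<theta> X) ;; \<sigma> Y (W \<odot> X)"
    using braid_natural_arr[of "\<one> Y" "\<one> W \<otimes> \<theta> X"] by simp
  finally show ?thesis
    by (simp add: wind_def comp_assoc_arr id_tens)
qed

definition ev' :: "'o \<Rightarrow> 'm" where
  "ev' X = wind X (Dual C X) (\<epsilon> X)"

text \<open>The cup matching the cap \<open>ev'\<close>, which makes the dual of \<open>X\<close> a
  dual on the other side as well. The formula is the middle part of \<open>lam\<close>, see
  \<open>lam_eq\<close>.\<close>

definition coev' :: "'o \<Rightarrow> 'm" where
  "coev' X = \<eta> X ;; ((\<one> X \<otimes> inv_arrow C (\<theta> (Dual C X))) ;; inv_arrow C (\<sigma> (Dual C X) X))"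

lemma pivotal_typing [simp]:
  assumes "X \<in> Obj C"
  shows "ev' X \<in> Arr C" "Dom C (ev' X) = X \<odot> Dual C X" "Cod C (ev' X) = Unit C"
    "coev' X \<in> Arr C" "Dom C (coev' X) = Unit C" "Cod C (coev' X) = Dual C X \<odot> X"
  using assms by (simp_all add: ev'_def coev'_def)

lemma pivotal_snake:
  assumes [simp]: "X \<in> Obj C"
  shows "(coev' X \<otimes> \<one> (Dual C X)) ;; (\<one> (Dual C X) \<otimes> ev' X) = \<one> (Dual C X)"
proof -
  let ?D = "Dual C X" and ?t = "inv_arrow C (\<theta> (Dual C X))"
  text \<open>Pulling the strand \<open>?D\<close> through \<open>ev'\<close> leaves a kink, which \<open>(\<theta> X)\<^sup>* = \<theta> ?D\<close> evaluates to \<open>\<theta> ?D\<close>.\<close>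
  have e: "\<one> ?D \<otimes> ev' X = (\<sigma> ?D X \<otimes> \<one> ?D) ;; ((\<one> X \<otimes> \<sigma> ?D ?D) ;; (ev' X \<otimes> \<one> ?D))"
    using braid_natural_arr[of "\<one> ?D" "ev' X"] by (simp add: braid_tens_right comp_assoc_arr)
  have c: "coev' X ;; \<sigma> ?D X = \<eta> X ;; (\<one> X \<otimes> ?t)"
    by (simp add: coev'_def comp_assoc_arr)
  have s: "(\<one> X \<otimes> \<sigma> ?D ?D) ;; (ev' X \<otimes> \<one> ?D)
      = \<sigma> (X \<odot> ?D) ?D ;; ((\<one> ?D \<otimes> \<theta> X \<otimes> \<one> ?D) ;; (\<epsilon> X \<otimes> \<one> ?D))"
  proof -
    have "ev' X \<otimes> \<one> ?D = (\<sigma> X ?D \<otimes> \<one> ?D) ;; ((\<one> ?D \<otimes> \<theta> X \<otimes> \<one> ?D) ;; (\<epsilon> X \<otimes> \<one> ?D))"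
      using comp_tens[of "\<one> ?D \<otimes> \<theta> X" "\<epsilon> X" "\<one> ?D" "\<one> ?D"]
        comp_tens[of "\<sigma> X ?D" "(\<one> ?D \<otimes> \<theta> X) ;; \<epsilon> X" "\<one> ?D" "\<one> ?D"]
      by (simp add: ev'_def wind_def)
    then show ?thesis
      by (simp add: braid_tens_left comp_assoc_arr)
  qed
  have "(coev' X \<otimes> \<one> ?D) ;; (\<one> ?D \<otimes> ev' X)
      = ((coev' X ;; \<sigma> ?D X) \<otimes> \<one> ?D) ;; ((\<one> X \<otimes> \<sigma> ?D ?D) ;; (ev' X \<otimes> \<one> ?D))"
    by (simp add: e merge)
  also have "\<dots> = ((\<eta> X ;; (\<one> X \<otimes> ?t)) \<otimes> \<one> ?D) ;; (\<sigma> (X \<odot> ?D) ?D ;;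
      ((\<one> ?D \<otimes> \<theta> X \<otimes> \<one> ?D) ;; (\<epsilon> X \<otimes> \<one> ?D)))"
    by (simp add: c s)
  \<comment> \<open>The cup starts at the unit object, so after naturality the crossing is a braid
    with the unit, which is an identity.\<close>
  also have "\<dots> = (\<one> ?D \<otimes> (\<eta> X ;; (\<one> X \<otimes> ?t))) ;;
      ((\<one> ?D \<otimes> \<theta> X \<otimes> \<one> ?D) ;; (\<epsilon> X \<otimes> \<one> ?D))"
    using braid_natural_arr[of "\<eta> X ;; (\<one> X \<otimes> ?t)" "\<one> ?D"]
    by (subst comp_assoc_arr[symmetric]) simp_all
  also have "\<dots> = (\<one> ?D \<otimes> \<eta> X) ;; ((\<one> ?D \<otimes> \<theta> X \<otimes> \<one> ?D) ;;
      ((\<one> ?D \<otimes> \<one> X \<otimes> ?t) ;; (\<epsilon> X \<otimes> \<one> ?D)))"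
    by (simp add: merge)
  \<comment> \<open>The inverse twist moves to the very end, where it cancels the
    \<open>\<theta> ?D\<close> that \<open>twist_dual\<close> produces.\<close>
  also have "(\<one> ?D \<otimes> \<one> X \<otimes> ?t) ;; (\<epsilon> X \<otimes> \<one> ?D) = (\<epsilon> X \<otimes> \<one> ?D) ;; ?t"
    using swap_tens[of "\<epsilon> X" ?t] by (simp add: id_tens)
  also have "(\<one> ?D \<otimes> \<eta> X) ;; ((\<one> ?D \<otimes> \<theta> X \<otimes> \<one> ?D) ;; ((\<epsilon> X \<otimes> \<one> ?D) ;; ?t))
      = ((\<one> ?D \<otimes> \<eta> X) ;; ((\<one> ?D \<otimes> \<theta> X \<otimes> \<one> ?D) ;; (\<epsilon> X \<otimes> \<one> ?D))) ;; ?t"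
    by (simp add: comp_assoc_arr)
  also have "(\<one> ?D \<otimes> \<eta> X) ;; ((\<one> ?D \<otimes> \<theta> X \<otimes> \<one> ?D) ;; (\<epsilon> X \<otimes> \<one> ?D)) = \<theta> ?D"
    using twist_dual[of X]
    by (simp add: dual_arrow_def Let_def comp_assoc_arr)
  finally show ?thesis
    by simp
qed

subsection \<open>Braidings and twists of either sign\<close>

text \<open>The properties shared by the braid and its inverse, so that an axiom with a sign is
  proved once for both. Invertibility is left out; it enters only where two signs have to
  cancel.\<close>

definition braiding :: "('o \<Rightarrow> 'o \<Rightarrow> 'm) \<Rightarrow> bool" where
  "braiding b \<longleftrightarrow>
    (\<forall>X\<in>Obj C. \<forall>Y\<in>Obj C. b X Y \<in> Hom C (X \<odot> Y) (Y \<odot> X)) \<and>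
    (\<forall>f\<in>Arr C. \<forall>g\<in>Arr C. (f \<otimes> g) ;; b (Cod C f) (Cod C g) = b (Dom C f) (Dom C g) ;; (g \<otimes> f)) \<and>
    (\<forall>X\<in>Obj C. b X (Unit C) = \<one> X \<and> b (Unit C) X = \<one> X) \<and>
    (\<forall>X\<in>Obj C. \<forall>Y\<in>Obj C. \<forall>Z\<in>Obj C.
      b X (Y \<odot> Z) = (b X Y \<otimes> \<one> Z) ;; (\<one> Y \<otimes> b X Z) \<and>
      b (X \<odot> Y) Z = (\<one> X \<otimes> b Y Z) ;; (b X Z \<otimes> \<one> Y))"

lemma braidingD:
  assumes "braiding b"
  shows "\<lbrakk>X \<in> Obj C; Y \<in> Obj C\<rbrakk> \<Longrightarrow> b X Y \<in> Arr C"
    "\<lbrakk>X \<in> Obj C; Y \<in> Obj C\<rbrakk> \<Longrightarrow> Dom C (b X Y) = X \<odot> Y"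
    "\<lbrakk>X \<in> Obj C; Y \<in> Obj C\<rbrakk> \<Longrightarrow> Cod C (b X Y) = Y \<odot> X"
    "X \<in> Obj C \<Longrightarrow> b X (Unit C) = \<one> X" "X \<in> Obj C \<Longrightarrow> b (Unit C) X = \<one> X"
  using assms by (simp_all add: braiding_def hom_iff)

lemma braiding_natural:
  "\<lbrakk>braiding b; f \<in> Arr C; g \<in> Arr C\<rbrakk>
    \<Longrightarrow> (f \<otimes> g) ;; b (Cod C f) (Cod C g) = b (Dom C f) (Dom C g) ;; (g \<otimes> f)"
  by (simp add: braiding_def)

lemma braiding_tens:
  assumes "braiding b" "X \<in> Obj C" "Y \<in> Obj C" "Z \<in> Obj C"
  shows "b X (Y \<odot> Z) = (b X Y \<otimes> \<one> Z) ;; (\<one> Y \<otimes> b X Z)"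
    "b (X \<odot> Y) Z = (\<one> X \<otimes> b Y Z) ;; (b X Z \<otimes> \<one> Y)"
  using assms by (simp_all add: braiding_def)

text \<open>Naturality of \<open>b X\<close> with respect to the crossing \<open>b Y Z\<close>, with
  both braids of a tensor product expanded by the hexagon.\<close>

lemma yang_baxter:
  assumes "braiding b" "X \<in> Obj C" "Y \<in> Obj C" "Z \<in> Obj C"
  shows "(\<one> X \<otimes> b Y Z) ;; ((b X Z \<otimes> \<one> Y) ;; (\<one> Z \<otimes> b X Y))
    = (b X Y \<otimes> \<one> Z) ;; ((\<one> Y \<otimes> b X Z) ;; (b Y Z \<otimes> \<one> X))"
proof -
  note [simp] = assms(2-4) braidingD[OF assms(1)]
  show ?thesis
    using braiding_natural[OF assms(1), of "\<one> X" "b Y Z"]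
    by (simp add: braiding_tens[OF assms(1)] comp_assoc_arr)
qed

lemma braiding_braid: "braiding \<sigma>"
  by (simp add: braiding_def hom_iff braid_natural_arr braid_tens_left braid_tens_right)

text \<open>The arguments are exchanged so that the inverse again goes from
  \<open>X \<odot> Y\<close> to \<open>Y \<odot> X\<close>. Naturality follows by conjugation, the
  hexagons by uniqueness of inverses; each hexagon comes from the opposite one.\<close>

lemma braiding_inv_braid: "braiding (\<lambda>X Y. inv_arrow C (\<sigma> Y X))"
proof -
  have "(f \<otimes> g) ;; inv_arrow C (\<sigma> (Cod C g) (Cod C f))
      = inv_arrow C (\<sigma> (Dom C g) (Dom C f)) ;; (g \<otimes> f)"
    if [simp]: "f \<in> Arr C" "g \<in> Arr C" for f g
  proof -
    let ?s = "\<sigma> (Dom C g) (Dom C f)" and ?s' = "\<sigma> (Cod C g) (Cod C f)"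
    have "(f \<otimes> g) ;; inv_arrow C ?s'
        = inv_arrow C ?s ;; ((?s ;; (f \<otimes> g)) ;; inv_arrow C ?s')"
      by (simp flip: comp_assoc_arr)
    also have "?s ;; (f \<otimes> g) = (g \<otimes> f) ;; ?s'"
      by (simp add: braid_natural_arr)
    finally show ?thesis
      by (simp add: comp_assoc_arr)
  qed
  moreover have "inv_arrow C (\<sigma> (Y \<odot> Z) X)
      = (inv_arrow C (\<sigma> Y X) \<otimes> \<one> Z) ;; (\<one> Y \<otimes> inv_arrow C (\<sigma> Z X))"
    if [simp]: "X \<in> Obj C" "Y \<in> Obj C" "Z \<in> Obj C" for X Y Z
    by (rule inv_arrow_eq) (simp add: inverse_arrows_def hom_iff braid_tens_left merge comp_id_tens)
  moreover have "inv_arrow C (\<sigma> Z (X \<odot> Y))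
      = (\<one> X \<otimes> inv_arrow C (\<sigma> Z Y)) ;; (inv_arrow C (\<sigma> Z X) \<otimes> \<one> Y)"
    if [simp]: "X \<in> Obj C" "Y \<in> Obj C" "Z \<in> Obj C" for X Y Z
    by (rule inv_arrow_eq) (simp add: inverse_arrows_def hom_iff braid_tens_right merge comp_id_tens)
  moreover have "inv_arrow C (\<one> X) = \<one> X" if "X \<in> Obj C" for X
    by (rule inv_arrow_eq) (simp add: inverse_arrows_def hom_iff that)
  ultimately show ?thesis
    by (simp add: braiding_def hom_iff)
qed

definition twisting :: "('o \<Rightarrow> 'm) \<Rightarrow> bool" where
  "twisting t \<longleftrightarrow>
    (\<forall>X\<in>Obj C. t X \<in> Hom C X X) \<and> (\<forall>f\<in>Arr C. f ;; t (Cod C f) = t (Dom C f) ;; f) \<and>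
    t (Unit C) = \<one> (Unit C)"

lemma twistingD:
  assumes "twisting t"
  shows "X \<in> Obj C \<Longrightarrow> t X \<in> Arr C" "X \<in> Obj C \<Longrightarrow> Dom C (t X) = X"
    "X \<in> Obj C \<Longrightarrow> Cod C (t X) = X" "t (Unit C) = \<one> (Unit C)"
    "f \<in> Arr C \<Longrightarrow> f ;; t (Cod C f) = t (Dom C f) ;; f"
  using assms by (simp_all add: twisting_def hom_iff)

lemma twisting_twist: "twisting \<theta>"
  using twist_natural by (simp add: twisting_def hom_iff)

lemma twisting_inv_twist: "twisting (\<lambda>X. inv_arrow C (\<theta> X))"
proof -
  have "f ;; inv_arrow C (\<theta> (Cod C f)) = inv_arrow C (\<theta> (Dom C f)) ;; f"
    if [simp]: "f \<in> Arr C" for f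
  proof -
    have "f ;; inv_arrow C (\<theta> (Cod C f))
        = inv_arrow C (\<theta> (Dom C f)) ;; ((\<theta> (Dom C f) ;; f) ;; inv_arrow C (\<theta> (Cod C f)))"
      by (simp flip: comp_assoc_arr)
    also have "\<theta> (Dom C f) ;; f = f ;; \<theta> (Cod C f)"
      using twistingD(5)[OF twisting_twist] by simp
    finally show ?thesis
      by (simp add: comp_assoc_arr)
  qed
  moreover have "inv_arrow C (\<one> (Unit C)) = \<one> (Unit C)"
    by (rule inv_arrow_eq) (simp add: inverse_arrows_def hom_iff)
  ultimately show ?thesis
    by (simp add: twisting_def hom_iff)
qed

text \<open>The twist of a tensor product with both twists placed on the left strand, the shape that
  the axiom for the composite of \<open>B\<close> with a twist yields on evaluation.\<close>

definition balance :: "('o \<Rightarrow> 'o \<Rightarrow> 'm) \<Rightarrow> ('o \<Rightarrow> 'm) \<Rightarrow> bool" where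
  "balance b t \<longleftrightarrow> (\<forall>X\<in>Obj C. \<forall>Y\<in>Obj C.
    t (X \<odot> Y) = (t X \<otimes> \<one> Y) ;; (b X Y ;; ((t Y \<otimes> \<one> X) ;; b Y X)))"

text \<open>Naturality moves one of the two parallel twists back across the first crossing.\<close>

lemma balanceI:
  assumes "braiding b" "twisting t"
    and "\<And>X Y. \<lbrakk>X \<in> Obj C; Y \<in> Obj C\<rbrakk> \<Longrightarrow> t (X \<odot> Y) = b X Y ;; ((t Y \<otimes> t X) ;; b Y X)"
  shows "balance b t"
  unfolding balance_def
proof (intro ballI)
  fix X Y
  assume [simp]: "X \<in> Obj C" "Y \<in> Obj C"
  note [simp] = braidingD[OF assms(1)] twistingD(1-3)[OF assms(2)]
  have "(t X \<otimes> \<one> Y) ;; b X Y = b X Y ;; (\<one> Y \<otimes> t X)"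
    using braiding_natural[OF assms(1), of "t X" "\<one> Y"] by simp
  then have "(t X \<otimes> \<one> Y) ;; (b X Y ;; ((t Y \<otimes> \<one> X) ;; b Y X))
      = b X Y ;; ((\<one> Y \<otimes> t X) ;; ((t Y \<otimes> \<one> X) ;; b Y X))"
    by (simp flip: comp_assoc_arr)
  then show "t (X \<odot> Y) = (t X \<otimes> \<one> Y) ;; (b X Y ;; ((t Y \<otimes> \<one> X) ;; b Y X))"
    by (simp add: assms(3) merge)
qed

lemma balance_twist: "balance \<sigma> \<theta>"
  by (rule balanceI) (simp_all add: braiding_braid twisting_twist twist_tens comp_assoc_arr)

lemma balance_inv_twist: "balance (\<lambda>X Y. inv_arrow C (\<sigma> Y X)) (\<lambda>X. inv_arrow C (\<theta> X))"
proof (rule balanceI)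
  fix X Y
  assume [simp]: "X \<in> Obj C" "Y \<in> Obj C"
  have cancel:
    "\<sigma> X Y ;; (inv_arrow C (\<sigma> X Y) ;; h) = h" if "X \<in> Obj C" "Y \<in> Obj C" "h \<in> Arr C" "Dom C h = X \<odot> Y" for X Y h
    using that by (simp flip: comp_assoc_arr)
  have cancel':
    "inv_arrow C (\<sigma> X Y) ;; (\<sigma> X Y ;; h) = h" if "X \<in> Obj C" "Y \<in> Obj C" "h \<in> Arr C" "Dom C h = Y \<odot> X" for X Y h
    using that by (simp flip: comp_assoc_arr)
  show "inv_arrow C (\<theta> (X \<odot> Y)) = inv_arrow C (\<sigma> Y X) ;;
      ((inv_arrow C (\<theta> Y) \<otimes> inv_arrow C (\<theta> X)) ;; inv_arrow C (\<sigma> X Y))"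
  proof (rule inv_arrow_eq)
    let ?f = "\<sigma> X Y ;; ((\<theta> Y \<otimes> \<theta> X) ;; \<sigma> Y X)"
    let ?g = "inv_arrow C (\<sigma> Y X) ;; ((inv_arrow C (\<theta> Y) \<otimes> inv_arrow C (\<theta> X)) ;; inv_arrow C (\<sigma> X Y))"
    have "?f ;; ?g = \<one> (X \<odot> Y)"
      by (simp add: comp_assoc_arr cancel comp_tens_assoc comp_id_tens)
    moreover have "?g ;; ?f = \<one> (X \<odot> Y)"
      by (simp add: comp_assoc_arr cancel' comp_tens_assoc comp_id_tens)
    ultimately show "inverse_arrows C (\<theta> (X \<odot> Y)) ?g"
      by (simp add: inverse_arrows_def hom_iff twist_tens comp_assoc_arr)
  qed
qed (rule braiding_inv_braid twisting_inv_twist)+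

end

section \<open>Application and abstraction\<close>

context reflexive_object
begin

abbreviation ap :: "'m \<Rightarrow> 'm \<Rightarrow> 'm"  (infixl "\<bullet>" 75) where
  "u \<bullet> v \<equiv> global_app C A \<phi> u v"

abbreviation "D \<equiv> Dual C A"
abbreviation "\<phi>' \<equiv> inv_arrow C \<phi>"

lemma refl_typing [simp]:
  "A \<in> Obj C" "\<phi> \<in> Arr C" "Dom C \<phi> = A \<odot> D" "Cod C \<phi> = A"
  "\<phi>' \<in> Arr C" "Dom C \<phi>' = A" "Cod C \<phi>' = A \<odot> D"
  "\<phi> ;; \<phi>' = \<one> (A \<odot> D)" "\<phi>' ;; \<phi> = \<one> A"
  using refl_obj refl_hom inv_arrow_simps[OF refl_iso] by (simp_all add: hom_iff)

lemma app_typing [simp]: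
  "app C A \<phi> \<in> Arr C" "Dom C (app C A \<phi>) = A \<odot> A" "Cod C (app C A \<phi>) = A"
  by (simp_all add: app_def)

lemma lam_eq: "lam C A \<phi> = (\<one> A \<otimes> coev' A) ;; (\<phi> \<otimes> \<one> A)"
  by (simp add: lam_def coev'_def merge)

lemma lam_typing [simp]:
  "lam C A \<phi> \<in> Arr C" "Dom C (lam C A \<phi>) = A" "Cod C (lam C A \<phi>) = A \<odot> A"
  by (simp_all add: lam_eq)

lemma ap_typing [simp]:
  assumes "u \<in> Arr C" "Cod C u = A" "v \<in> Arr C" "Cod C v = A"
  shows "u \<bullet> v \<in> Arr C" "Dom C (u \<bullet> v) = Dom C u \<odot> Dom C v" "Cod C (u \<bullet> v) = A"
  using assms by (simp_all add: global_app_def)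

lemma comp_ap:
  assumes "u \<in> Arr C" "Cod C u = A" "v \<in> Arr C" "Cod C v = A"
    "p \<in> Arr C" "Cod C p = Dom C u" "q \<in> Arr C" "Cod C q = Dom C v"
  shows "(p \<otimes> q) ;; (u \<bullet> v) = (p ;; u) \<bullet> (q ;; v)"
  using assms by (simp add: global_app_def merge)

lemma ap_id:
  assumes [simp]: "u \<in> Arr C" "Cod C u = A"
  shows "u \<bullet> \<one> A = ((u ;; \<phi>') \<otimes> \<one> A) ;; (\<one> A \<otimes> \<epsilon> A)"
  by (simp add: global_app_def app_def merge)

text \<open>An explicit left inverse of applying to the identity: open a new pair of strands by
  \<open>\<eta> A\<close>, feed one to the application, and store the other by
  \<open>\<phi>\<close>. \<open>snake_dual\<close> straightens the result.\<close>

lemma recover: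
  assumes [simp]: "u \<in> Arr C" "Cod C u = A"
  shows "(\<one> (Dom C u) \<otimes> \<eta> A) ;; (((u \<bullet> \<one> A) \<otimes> \<one> D) ;; \<phi>) = u"
proof -
  let ?v = "u ;; \<phi>'"
  have "(u \<bullet> \<one> A) \<otimes> \<one> D = (?v \<otimes> \<one> A \<otimes> \<one> D) ;; (\<one> A \<otimes> \<epsilon> A \<otimes> \<one> D)"
    using comp_tens[of "?v \<otimes> \<one> A" "\<one> A \<otimes> \<epsilon> A" "\<one> D" "\<one> D"] by (simp add: ap_id)
  then have "(\<one> (Dom C u) \<otimes> \<eta> A) ;; (((u \<bullet> \<one> A) \<otimes> \<one> D) ;; \<phi>)
      = ((\<one> (Dom C u) \<otimes> \<eta> A) ;; (?v \<otimes> \<one> (A \<odot> D))) ;; ((\<one> A \<otimes> \<epsilon> A \<otimes> \<one> D) ;; \<phi>)"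
    by (simp add: comp_assoc_arr id_tens)
  also have "(\<one> (Dom C u) \<otimes> \<eta> A) ;; (?v \<otimes> \<one> (A \<odot> D)) = ?v ;; (\<one> (A \<odot> D) \<otimes> \<eta> A)"
    using swap_tens[of ?v "\<eta> A"] by simp
  also have "(?v ;; (\<one> (A \<odot> D) \<otimes> \<eta> A)) ;; ((\<one> A \<otimes> \<epsilon> A \<otimes> \<one> D) ;; \<phi>)
      = ?v ;; ((\<one> A \<otimes> ((\<one> D \<otimes> \<eta> A) ;; (\<epsilon> A \<otimes> \<one> D))) ;; \<phi>)"
    by (simp add: merge)
  also have "\<dots> = u"
    by (simp add: snake_dual tens_id comp_assoc_arr)
  finally show ?thesis .
qed

lemma ap_ext:
  assumes "u \<in> Arr C" "Cod C u = A" "v \<in> Arr C" "Cod C v = A" "Dom C u = Dom C v"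
    "u \<bullet> \<one> A = v \<bullet> \<one> A"
  shows "u = v"
  using recover[of u] recover[of v] assms by metis

text \<open>The beta rule inside a trace: the strand that \<open>lam\<close> emits is wound around
  the loop, and application replaces it by a fresh input on the right. The prefix \<open>p\<close>
  leaves room for further abstractions.\<close>

lemma lam_wind:
  assumes [simp]: "Z \<in> Obj C" "j \<in> Arr C" "Dom C j = Z \<odot> A" "Cod C j = Unit C"
    "p \<in> Arr C" "Cod C p = A \<odot> Z"
  shows "(p ;; ((lam C A \<phi> \<otimes> \<one> Z) ;; (\<one> A \<otimes> wind A Z j))) \<bullet> \<one> A
    = (p \<otimes> \<one> A) ;; (\<one> A \<otimes> j)"
proof -
  \<comment> \<open>The transpose of \<open>j\<close>, from which \<open>j\<close> is recovered by
    \<open>\<epsilon> A\<close>; it turns the winding of an arbitrary \<open>j\<close> into the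
    single cap \<open>ev' A\<close>.\<close>
  define t where "t = (\<one> Z \<otimes> \<eta> A) ;; (j \<otimes> \<one> D)"
  have [simp]: "t \<in> Arr C" "Dom C t = Z" "Cod C t = D"
    by (simp_all add: t_def)
  have j: "(t \<otimes> \<one> A) ;; \<epsilon> A = j"
  proof -
    have "t \<otimes> \<one> A = (\<one> Z \<otimes> \<eta> A \<otimes> \<one> A) ;; (j \<otimes> \<one> D \<otimes> \<one> A)"
      using comp_tens[of "\<one> Z \<otimes> \<eta> A" "j \<otimes> \<one> D" "\<one> A" "\<one> A"] by (simp add: t_def)
    moreover have "(j \<otimes> \<one> D \<otimes> \<one> A) ;; \<epsilon> A = (\<one> Z \<otimes> \<one> A \<otimes> \<epsilon> A) ;; j"
      using swap_tens[of j "\<epsilon> A"] by (simp add: id_tens)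
    ultimately have "(t \<otimes> \<one> A) ;; \<epsilon> A
        = (\<one> Z \<otimes> ((\<eta> A \<otimes> \<one> A) ;; (\<one> A \<otimes> \<epsilon> A))) ;; j"
      by (simp add: merge)
    then show ?thesis
      by (simp add: snake tens_id)
  qed
  have w: "wind A Z j = (\<one> A \<otimes> t) ;; ev' A"
    using wind_natural[of "\<one> A" A A t Z D "\<epsilon> A"] by (simp add: j ev'_def)
  have l: "lam C A \<phi> \<otimes> \<one> Z = (\<one> A \<otimes> coev' A \<otimes> \<one> Z) ;; (\<phi> \<otimes> \<one> A \<otimes> \<one> Z)"
    using comp_tens[of "\<one> A \<otimes> coev' A" "\<phi> \<otimes> \<one> A" "\<one> Z" "\<one> Z"] by (simp add: lam_eq)
  \<comment> \<open>In \<open>b\<close>, \<open>c\<close> and \<open>d\<close>, the arrow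
    \<open>t\<close> and the cap slide past \<open>\<phi>\<close> and the cup, until cup and cap are
    adjacent and \<open>pivotal_snake\<close> applies.\<close>
  have b: "(\<phi> \<otimes> \<one> A \<otimes> \<one> Z) ;; (\<one> A \<otimes> \<one> A \<otimes> t) = (\<one> A \<otimes> \<one> D \<otimes> \<one> A \<otimes> t) ;; (\<phi> \<otimes> \<one> A \<otimes> \<one> D)"
    using swap_tens[of \<phi> "\<one> A \<otimes> t"] by (simp add: id_tens)
  have c: "(\<one> A \<otimes> coev' A \<otimes> \<one> Z) ;; (\<one> A \<otimes> \<one> D \<otimes> \<one> A \<otimes> t) = (\<one> A \<otimes> t) ;; (\<one> A \<otimes> coev' A \<otimes> \<one> D)"
    using swap_tens[of "coev' A" t] by (simp add: merge)
  have d: "(\<phi> \<otimes> \<one> A \<otimes> \<one> D) ;; (\<one> A \<otimes> ev' A) = (\<one> A \<otimes> \<one> D \<otimes> ev' A) ;; \<phi>"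
    using swap_tens[of \<phi> "ev' A"] by (simp add: id_tens)
  have "(lam C A \<phi> \<otimes> \<one> Z) ;; (\<one> A \<otimes> wind A Z j)
      = (\<one> A \<otimes> coev' A \<otimes> \<one> Z) ;; (((\<phi> \<otimes> \<one> A \<otimes> \<one> Z) ;; (\<one> A \<otimes> \<one> A \<otimes> t)) ;; (\<one> A \<otimes> ev' A))"
    by (simp add: w l merge)
  also have "\<dots> = ((\<one> A \<otimes> coev' A \<otimes> \<one> Z) ;; (\<one> A \<otimes> \<one> D \<otimes> \<one> A \<otimes> t)) ;;
      ((\<phi> \<otimes> \<one> A \<otimes> \<one> D) ;; (\<one> A \<otimes> ev' A))"
    unfolding b by (simp add: comp_assoc_arr)
  also have "\<dots> = (\<one> A \<otimes> t) ;; ((\<one> A \<otimes> ((coev' A \<otimes> \<one> D) ;; (\<one> D \<otimes> ev' A))) ;; \<phi>)"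
    unfolding c d by (simp add: merge)
  also have "\<dots> = (\<one> A \<otimes> t) ;; \<phi>"
    by (simp add: pivotal_snake tens_id)
  finally have "(p ;; ((lam C A \<phi> \<otimes> \<one> Z) ;; (\<one> A \<otimes> wind A Z j))) \<bullet> \<one> A
      = ((p ;; (\<one> A \<otimes> t)) \<otimes> \<one> A) ;; (\<one> A \<otimes> \<epsilon> A)"
    by (simp add: ap_id comp_assoc_arr)
  also have "\<dots> = (p \<otimes> \<one> A) ;; ((\<one> A \<otimes> t \<otimes> \<one> A) ;; (\<one> A \<otimes> \<epsilon> A))"
    by (simp add: whisker comp_assoc_arr)
  also have "(\<one> A \<otimes> t \<otimes> \<one> A) ;; (\<one> A \<otimes> \<epsilon> A) = \<one> A \<otimes> j"
    by (simp add: comp_tens j)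
  finally show ?thesis .
qed

section \<open>Iterated abstraction and the evaluation of closed terms\<close>

abbreviation "pow \<equiv> tens_pow C A"

lemma pow_obj [simp]: "pow n \<in> Obj C"
  by (induction n) simp_all

lemma lam_n_typing [simp]:
  "lam_n C A \<phi> n \<in> Arr C" "Dom C (lam_n C A \<phi> n) = A" "Cod C (lam_n C A \<phi> n) = A \<odot> pow n"
  by (induction n) simp_all

lemma app_n_typing [simp]:
  "app_n C A \<phi> n \<in> Arr C" "Dom C (app_n C A \<phi> n) = A \<odot> pow n" "Cod C (app_n C A \<phi> n) = A"
  by (induction n) simp_all

primrec ap_ids :: "'m \<Rightarrow> nat \<Rightarrow> 'm" where
  "ap_ids u 0 = u"
| "ap_ids u (Suc n) = ap_ids (u \<bullet> \<one> A) n"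

text \<open>By induction: \<open>wind_tens\<close> splits off one strand, and
  \<open>lam_wind\<close> cancels the last \<open>lam\<close> against the first application. The new
  input joins \<open>Z\<close>, hence the generalisation over \<open>Z\<close>, \<open>j\<close> and
  \<open>p\<close>.\<close>

lemma lam_n_wind:
  assumes "Z \<in> Obj C" "j \<in> Arr C" "Dom C j = Z \<odot> pow n" "Cod C j = Unit C"
    "p \<in> Arr C" "Cod C p = A \<odot> Z"
  shows "ap_ids (p ;; ((lam_n C A \<phi> n \<otimes> \<one> Z) ;; (\<one> A \<otimes> wind (pow n) Z j))) n
    = (p \<otimes> \<one> (pow n)) ;; (\<one> A \<otimes> j)"
  using assms
proof (induction n arbitrary: p Z j)
  case 0
  then show ?case
    by (simp add: wind_def tens_id)
next
  case (Suc n)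
  note [simp] = Suc.prems
  let ?p = "p ;; (lam_n C A \<phi> n \<otimes> \<one> Z)" and ?j = "wind (pow n) (Z \<odot> A) j"
  have "lam_n C A \<phi> (Suc n) \<otimes> \<one> Z = (lam_n C A \<phi> n \<otimes> \<one> Z) ;; (lam C A \<phi> \<otimes> \<one> (pow n \<odot> Z))"
    using comp_tens[of "lam_n C A \<phi> n" "lam C A \<phi> \<otimes> \<one> (pow n)" "\<one> Z" "\<one> Z"] by (simp add: id_tens)
  then have "p ;; ((lam_n C A \<phi> (Suc n) \<otimes> \<one> Z) ;; (\<one> A \<otimes> wind (pow (Suc n)) Z j))
      = ?p ;; ((lam C A \<phi> \<otimes> \<one> (pow n \<odot> Z)) ;; (\<one> A \<otimes> wind A (pow n \<odot> Z) ?j))"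
    by (simp add: wind_tens comp_assoc_arr)
  then have "ap_ids (p ;; ((lam_n C A \<phi> (Suc n) \<otimes> \<one> Z) ;; (\<one> A \<otimes> wind (pow (Suc n)) Z j))) (Suc n)
      = ap_ids ((?p \<otimes> \<one> A) ;; (\<one> A \<otimes> ?j)) n"
    using lam_wind[of "pow n \<odot> Z" ?j ?p] by simp
  also have "(?p \<otimes> \<one> A) ;; (\<one> A \<otimes> ?j)
      = (p \<otimes> \<one> A) ;; ((lam_n C A \<phi> n \<otimes> \<one> (Z \<odot> A)) ;; (\<one> A \<otimes> ?j))"
    by (simp add: whisker comp_assoc_arr id_tens)
  also have "ap_ids \<dots> n = ((p \<otimes> \<one> A) \<otimes> \<one> (pow n)) ;; (\<one> A \<otimes> j)"
    by (rule Suc.IH) simp_all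
  finally show ?case
    by (simp add: id_tens)
qed

lemma close_arrow_typing:
  assumes [simp]: "f \<in> Arr C" "Dom C f = pow m" "Cod C f = pow n"
  shows "close_arrow C A \<phi> m n f \<in> Arr C" "Dom C (close_arrow C A \<phi> m n f) = Unit C"
    "Cod C (close_arrow C A \<phi> m n f) = A"
  by (simp_all add: close_arrow_def trace_def Let_def)

text \<open>The defining property of closed terms. One application more than \<open>m\<close> is
  needed, since the head variable in front of \<open>f\<close> is abstracted as well.\<close>

lemma ap_ids_close_arrow:
  assumes [simp]: "f \<in> Arr C" "Dom C f = pow m" "Cod C f = pow n"
  shows "ap_ids (close_arrow C A \<phi> m n f) (Suc m) = (\<one> A \<otimes> f) ;; app_n C A \<phi> n"
proof -
  let ?k = "(\<one> A \<otimes> f) ;; app_n C A \<phi> n"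
  let ?l = "lam_n C A \<phi> (Suc m)"
  have ev: "\<sigma> A D ;; ((\<one> D \<otimes> \<theta> A) ;; \<epsilon> A) = ev' A"
    by (simp add: ev'_def wind_def)
  \<comment> \<open>The body is carried through the cap of the trace, so that only abstractions stay
    on the near side of the loop.\<close>
  have k: "(?k \<otimes> \<one> D) ;; ev' A = wind (pow (Suc m)) D ((\<one> D \<otimes> ?k) ;; \<epsilon> A)"
    unfolding ev'_def by (rule wind_natural) simp_all
  \<comment> \<open>The extra \<open>lam\<close> beside \<open>f\<close> is the last of
    \<open>Suc m\<close> abstractions, and everything after it acts on the strands beside the
    loop.\<close>
  have "lam_n C A \<phi> m ;; ((lam C A \<phi> \<otimes> f) ;; (\<one> A \<otimes> app_n C A \<phi> n)) = ?l ;; (\<one> A \<otimes> ?k)"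
    using comp_tens[of "lam C A \<phi>" "\<one> (A \<odot> A)" "\<one> (pow m)" f, symmetric]
    by (simp add: whisker comp_assoc_arr id_tens comp_id_tens)
  then have "close_arrow C A \<phi> m n f = \<eta> A ;; (((?l ;; (\<one> A \<otimes> ?k)) \<otimes> \<one> D) ;; (\<one> A \<otimes> ev' A))"
    by (simp add: close_arrow_def trace_def Let_def comp_assoc_arr ev)
  also have "\<dots> = \<eta> A ;; ((?l \<otimes> \<one> D) ;; (\<one> A \<otimes> ((?k \<otimes> \<one> D) ;; ev' A)))"
    by (simp add: whisker comp_assoc_arr del: lam_n.simps)
  also have "\<dots> = \<eta> A ;; ((?l \<otimes> \<one> D) ;; (\<one> A \<otimes> wind (pow (Suc m)) D ((\<one> D \<otimes> ?k) ;; \<epsilon> A)))"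
    by (simp only: k)
  finally have "ap_ids (close_arrow C A \<phi> m n f) (Suc m)
      = (\<eta> A \<otimes> \<one> (pow (Suc m))) ;; (\<one> A \<otimes> ((\<one> D \<otimes> ?k) ;; \<epsilon> A))"
    using lam_n_wind[of D "(\<one> D \<otimes> ?k) ;; \<epsilon> A" "Suc m" "\<eta> A"]
    by (simp del: lam_n.simps ap_ids.simps)
  also have "\<dots> = ((\<eta> A \<otimes> \<one> (pow (Suc m))) ;; (\<one> (A \<odot> D) \<otimes> ?k)) ;; (\<one> A \<otimes> \<epsilon> A)"
    by (simp add: merge)
  \<comment> \<open>Once the body slides in front of the cup, the loop is a plain snake.\<close>
  also have "(\<eta> A \<otimes> \<one> (pow (Suc m))) ;; (\<one> (A \<odot> D) \<otimes> ?k) = ?k ;; (\<eta> A \<otimes> \<one> A)"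
    using swap_tens[of "\<eta> A" ?k] by simp
  also have "\<dots> ;; (\<one> A \<otimes> \<epsilon> A) = ?k"
    by (simp add: comp_assoc_arr snake)
  finally show ?thesis .
qed

subsection \<open>Combinators\<close>

definition "KB = close_arrow C A \<phi> 2 1 (app C A \<phi>)"
definition "KC b = close_arrow C A \<phi> 2 2 (b A A)"
definition "KI = close_arrow C A \<phi> 0 0 (\<one> (Unit C))"
definition "KT t = close_arrow C A \<phi> 1 1 (t A)"

lemma pow_numeral [simp]: "pow 2 = A \<odot> A"
  by (simp add: numeral_2_eq_2)

lemma KB_typing [simp]: "KB \<in> Arr C" "Dom C KB = Unit C" "Cod C KB = A"
  by (simp_all add: KB_def close_arrow_typing)

lemma KI_typing [simp]: "KI \<in> Arr C" "Dom C KI = Unit C" "Cod C KI = A"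
  by (simp_all add: KI_def close_arrow_typing)

lemma KC_typing:
  assumes "braiding b"
  shows "KC b \<in> Arr C" "Dom C (KC b) = Unit C" "Cod C (KC b) = A"
  using braidingD[OF assms] by (simp_all add: KC_def close_arrow_typing)

lemma KT_typing:
  assumes "twisting t"
  shows "KT t \<in> Arr C" "Dom C (KT t) = Unit C" "Cod C (KT t) = A"
  using twistingD[OF assms] by (simp_all add: KT_def close_arrow_typing)

lemma ap_comp:
  assumes "u \<in> Arr C" "Cod C u = A" "v \<in> Arr C" "Cod C v = A"
  shows "\<lbrakk>p \<in> Arr C; Cod C p = Dom C u\<rbrakk> \<Longrightarrow> (p ;; u) \<bullet> v = (p \<otimes> \<one> (Dom C v)) ;; (u \<bullet> v)"
    "\<lbrakk>p \<in> Arr C; Cod C p = Dom C v\<rbrakk> \<Longrightarrow> u \<bullet> (p ;; v) = (\<one> (Dom C u) \<otimes> p) ;; (u \<bullet> v)"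
  using assms by (simp_all add: comp_ap)

text \<open>A point has the unit as domain, so its arguments can be pulled out in front. This and
  the next two lemmas extend the values of closed terms at identities to all arguments.\<close>

lemma point_ap1:
  assumes "x \<in> Arr C" "Dom C x = Unit C" "Cod C x = A" "u \<in> Arr C" "Cod C u = A"
  shows "x \<bullet> u = u ;; (x \<bullet> \<one> A)"
  using comp_ap[of x "\<one> A" "\<one> (Unit C)" u] assms by simp

lemma point_ap2:
  assumes "x \<in> Arr C" "Dom C x = Unit C" "Cod C x = A" "u \<in> Arr C" "Cod C u = A"
    "v \<in> Arr C" "Cod C v = A"
  shows "x \<bullet> u \<bullet> v = (u \<otimes> v) ;; (x \<bullet> \<one> A \<bullet> \<one> A)"
proof -
  have "(u \<otimes> v) ;; (x \<bullet> \<one> A \<bullet> \<one> A) = (u ;; (x \<bullet> \<one> A)) \<bullet> (v ;; \<one> A)"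
    by (rule comp_ap) (use assms in simp_all)
  then show ?thesis
    using point_ap1[of x u] assms by simp
qed

lemma point_ap3:
  assumes "x \<in> Arr C" "Dom C x = Unit C" "Cod C x = A" "u \<in> Arr C" "Cod C u = A"
    "v \<in> Arr C" "Cod C v = A" "w \<in> Arr C" "Cod C w = A"
  shows "x \<bullet> u \<bullet> v \<bullet> w = (u \<otimes> v \<otimes> w) ;; (x \<bullet> \<one> A \<bullet> \<one> A \<bullet> \<one> A)"
proof -
  have "((u \<otimes> v) \<otimes> w) ;; (x \<bullet> \<one> A \<bullet> \<one> A \<bullet> \<one> A)
      = ((u \<otimes> v) ;; (x \<bullet> \<one> A \<bullet> \<one> A)) \<bullet> (w ;; \<one> A)"
    by (rule comp_ap) (use assms in simp_all)
  then show ?thesis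
    using point_ap2[of x u v] assms by simp
qed

lemma KB_app [simp]:
  assumes [simp]: "u \<in> Arr C" "Cod C u = A" "v \<in> Arr C" "Cod C v = A" "w \<in> Arr C" "Cod C w = A"
  shows "KB \<bullet> u \<bullet> v \<bullet> w = u \<bullet> (v \<bullet> w)"
proof -
  have "KB \<bullet> \<one> A \<bullet> \<one> A \<bullet> \<one> A = (\<one> A \<otimes> app C A \<phi>) ;; app C A \<phi>"
    using ap_ids_close_arrow[of "app C A \<phi>" 2 1] by (simp add: KB_def numeral_2_eq_2)
  then have "KB \<bullet> u \<bullet> v \<bullet> w = (u \<otimes> v \<otimes> w) ;; ((\<one> A \<otimes> app C A \<phi>) ;; app C A \<phi>)"
    using point_ap3[of KB u v w] by simp
  then show ?thesis
    by (simp add: global_app_def merge)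
qed

lemma KI_app [simp]:
  assumes [simp]: "u \<in> Arr C" "Cod C u = A"
  shows "KI \<bullet> u = u"
proof -
  have "KI \<bullet> \<one> A = \<one> A"
    using ap_ids_close_arrow[of "\<one> (Unit C)" 0 0] by (simp add: KI_def)
  then show ?thesis
    using point_ap1[of KI u] by simp
qed

lemma KT_app:
  assumes "twisting t" and [simp]: "u \<in> Arr C" "Cod C u = A" "v \<in> Arr C" "Cod C v = A"
  shows "KT t \<bullet> u \<bullet> v = (\<one> (Dom C u) \<otimes> t (Dom C v)) ;; (u \<bullet> v)"
proof -
  note [simp] = twistingD(1-3)[OF assms(1)] KT_typing[OF assms(1)]
  have "KT t \<bullet> \<one> A \<bullet> \<one> A = (\<one> A \<otimes> t A) ;; app C A \<phi>"
    using ap_ids_close_arrow[of "t A" 1 1] by (simp add: KT_def)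
  then have "KT t \<bullet> u \<bullet> v = (u \<otimes> v) ;; ((\<one> A \<otimes> t A) ;; app C A \<phi>)"
    using point_ap2[of "KT t" u v] by simp
  also have "\<dots> = (u \<otimes> (v ;; t A)) ;; app C A \<phi>"
    by (simp add: merge)
  also have "v ;; t A = t (Dom C v) ;; v"
    using twistingD(5)[OF assms(1), of v] by simp
  finally show ?thesis
    by (simp add: global_app_def merge)
qed

text \<open>Naturality moves the crossing from \<open>A\<close> to the domains of the arguments.
  Domains stay arbitrary because arguments may be applications, with a tensor product as domain, or
  points, with trivial crossing.\<close>

lemma KC_app:
  assumes "braiding b" and [simp]: "u \<in> Arr C" "Cod C u = A" "v \<in> Arr C" "Cod C v = A"
    "w \<in> Arr C" "Cod C w = A"
  shows "KC b \<bullet> u \<bullet> v \<bullet> w = (\<one> (Dom C u) \<otimes> b (Dom C v) (Dom C w)) ;; (u \<bullet> w \<bullet> v)"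
proof -
  note [simp] = braidingD[OF assms(1)] KC_typing[OF assms(1)]
  let ?a = "(app C A \<phi> \<otimes> \<one> A) ;; app C A \<phi>"
  have "KC b \<bullet> \<one> A \<bullet> \<one> A \<bullet> \<one> A = (\<one> A \<otimes> b A A) ;; ?a"
    using ap_ids_close_arrow[of "b A A" 2 2] by (simp add: KC_def numeral_2_eq_2)
  then have "KC b \<bullet> u \<bullet> v \<bullet> w = (u \<otimes> v \<otimes> w) ;; ((\<one> A \<otimes> b A A) ;; ?a)"
    using point_ap3[of "KC b" u v w] by simp
  also have "\<dots> = (u \<otimes> ((v \<otimes> w) ;; b A A)) ;; ?a"
    by (simp add: merge)
  also have "(v \<otimes> w) ;; b A A = b (Dom C v) (Dom C w) ;; (w \<otimes> v)"
    using braiding_natural[OF assms(1), of v w] by simp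
  also have "(u \<otimes> (b (Dom C v) (Dom C w) ;; (w \<otimes> v))) ;; ?a
      = (\<one> (Dom C u) \<otimes> b (Dom C v) (Dom C w)) ;; (((u \<otimes> w) \<otimes> v) ;; ?a)"
    by (simp add: merge)
  also have "((u \<otimes> w) \<otimes> v) ;; ?a = u \<bullet> w \<bullet> v"
    unfolding global_app_def by (subst comp_tens_assoc) simp_all
  finally show ?thesis .
qed

section \<open>Extensionality for points\<close>

abbreviation "Pts \<equiv> Hom C (Unit C) A"

lemma pts_ext:
  assumes "u \<in> Pts" "v \<in> Pts" "u \<bullet> \<one> A = v \<bullet> \<one> A"
  shows "u = v"
  using assms ap_ext[of u v] by (auto simp: hom_iff)

lemma pts_ext2:
  assumes "u \<in> Pts" "v \<in> Pts" "u \<bullet> \<one> A \<bullet> \<one> A = v \<bullet> \<one> A \<bullet> \<one> A"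
  shows "u = v"
  using assms by (intro pts_ext[of u v] ap_ext[of "u \<bullet> \<one> A" "v \<bullet> \<one> A"]) (auto simp: hom_iff)

lemma pts_ext3:
  assumes "u \<in> Pts" "v \<in> Pts" "u \<bullet> \<one> A \<bullet> \<one> A \<bullet> \<one> A = v \<bullet> \<one> A \<bullet> \<one> A \<bullet> \<one> A"
  shows "u = v"
  using assms by (intro pts_ext2[of u v] ap_ext[of "u \<bullet> \<one> A \<bullet> \<one> A" "v \<bullet> \<one> A \<bullet> \<one> A"]) (auto simp: hom_iff)

lemma pts_ext4:
  assumes "u \<in> Pts" "v \<in> Pts" "u \<bullet> \<one> A \<bullet> \<one> A \<bullet> \<one> A \<bullet> \<one> A = v \<bullet> \<one> A \<bullet> \<one> A \<bullet> \<one> A \<bullet> \<one> A"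
  shows "u = v"
  using assms
  by (intro pts_ext3[of u v] ap_ext[of "u \<bullet> \<one> A \<bullet> \<one> A \<bullet> \<one> A" "v \<bullet> \<one> A \<bullet> \<one> A \<bullet> \<one> A"]) (auto simp: hom_iff)

lemmas eval_simps = hom_iff ap_comp comp_assoc_arr id_tens

section \<open>The algebra axioms, for an arbitrary braiding and twisting\<close>

context
  fixes b
  assumes b: "braiding b"
begin

lemmas [simp] = braidingD[OF b] KC_typing[OF b] KC_app[OF b]

lemma KC_eq: "\<lbrakk>u \<in> Pts; v \<in> Pts; w \<in> Pts\<rbrakk> \<Longrightarrow> KC b \<bullet> u \<bullet> v \<bullet> w = u \<bullet> w \<bullet> v"
  by (simp add: hom_iff)

text \<open>Here, in \<open>KC_KB_KB\<close> and in \<open>KC_KB_KC\<close>, the argument moved by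
  the outer \<open>KC b\<close> is a point, so its crossing is an identity and the sign is
  irrelevant.\<close>

lemma KC_KB_KI: "KC b \<bullet> KB \<bullet> KI = KB \<bullet> KI"
  by (rule pts_ext2) (simp_all add: eval_simps comp_id_tens)

lemma KC_KB_KB: "KB \<bullet> (KC b \<bullet> KB \<bullet> KB) \<bullet> (KB \<bullet> KB \<bullet> KB) = KB \<bullet> (KB \<bullet> KB) \<bullet> KB"
  by (rule pts_ext4) (simp_all add: eval_simps)

lemma KC_inverse:
  assumes b': "braiding b'" and inv: "\<And>X Y. \<lbrakk>X \<in> Obj C; Y \<in> Obj C\<rbrakk> \<Longrightarrow> b X Y ;; b' Y X = \<one> (X \<odot> Y)"
  shows "KB \<bullet> KC b \<bullet> KC b' = KB \<bullet> (KB \<bullet> KI)"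
proof -
  note [simp] = braidingD[OF b'] KC_typing[OF b'] KC_app[OF b']
  show ?thesis
    by (rule pts_ext3) (simp_all add: eval_simps merge inv comp_id_tens)
qed

lemma KC_KB_KC:
  assumes b': "braiding b'"
  shows "KB \<bullet> (KC b \<bullet> KB \<bullet> KC b') \<bullet> (KB \<bullet> KB \<bullet> KB) = KB \<bullet> (KB \<bullet> KC b') \<bullet> (KB \<bullet> KB \<bullet> KB)"
proof -
  note [simp] = braidingD[OF b'] KC_typing[OF b'] KC_app[OF b']
  show ?thesis
    by (rule pts_ext4) (simp_all add: eval_simps)
qed

text \<open>Both sides reverse the last three arguments, along the two sides of the Yang-Baxter
  equation.\<close>

lemma KC_yang_baxter:
  "KB \<bullet> (KB \<bullet> KC b) \<bullet> (KB \<bullet> KC b \<bullet> (KB \<bullet> KC b)) = KB \<bullet> KC b \<bullet> (KB \<bullet> (KB \<bullet> KC b) \<bullet> KC b)"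
  by (rule pts_ext4) (simp_all add: eval_simps merge yang_baxter[OF b])

text \<open>The left side crosses a strand with an application, hence with
  \<open>A \<odot> A\<close>; the right side crosses its two strands one after the other. This is a
  hexagon.\<close>

lemma KB_KB_KC: "KB \<bullet> (KB \<bullet> KB) \<bullet> KC b = KB \<bullet> KC b \<bullet> (KB \<bullet> (KB \<bullet> KC b) \<bullet> KB)"
  by (rule pts_ext4) (simp_all add: eval_simps merge braiding_tens[OF b])

text \<open>On both sides the twist ends up on the strand of the last argument.\<close>

lemma KB_KT:
  assumes t: "twisting t"
  shows "KB \<bullet> (KB \<bullet> KT t) \<bullet> KB = KB \<bullet> (KC b \<bullet> KB \<bullet> KT t) \<bullet> KB"
proof -
  note [simp] = twistingD(1-4)[OF t] KT_typing[OF t] KT_app[OF t]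
  show ?thesis
    by (rule pts_ext3) (simp_all add: eval_simps)
qed

text \<open>The exchange puts the twist on the point \<open>a\<close>, that is on the unit object,
  where it is trivial.\<close>

lemma KC_KT:
  assumes t: "twisting t" and b': "braiding b'" and "a \<in> Pts"
  shows "KC b \<bullet> KT t \<bullet> a = KC b' \<bullet> KI \<bullet> a"
proof -
  note [simp] = twistingD(1-4)[OF t] KT_typing[OF t] KT_app[OF t]
    braidingD[OF b'] KC_typing[OF b'] KC_app[OF b']
  show ?thesis
    by (rule pts_ext) (use assms(3) in \<open>simp_all add: eval_simps\<close>)
qed

text \<open>The left side twists an application, hence \<open>A \<odot> A\<close>; the right side
  evaluates to the expansion given by \<open>balance\<close>.\<close>

lemma KB_comp_KT:
  assumes t: "twisting t" and "balance b t"
  shows "KB \<bullet> KB \<bullet> KT t = KB \<bullet> KT t \<bullet> (KB \<bullet> KC b \<bullet> (KB \<bullet> KT t \<bullet> (KB \<bullet> KC b \<bullet> KB)))"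
proof -
  note [simp] = twistingD(1-4)[OF t] KT_typing[OF t] KT_app[OF t]
  have "t (A \<odot> A) = (t A \<otimes> \<one> A) ;; (b A A ;; ((t A \<otimes> \<one> A) ;; b A A))"
    using assms(2) by (simp add: balance_def)
  note [simp] = this
  show ?thesis
    by (rule pts_ext3) (simp_all add: eval_simps merge)
qed

end

lemma KB_KI: "KB \<bullet> KI = KI"
  by (rule pts_ext2) (simp_all add: eval_simps)

lemma KT_inverse:
  assumes t: "twisting t" "twisting t'" and inv: "\<And>X. X \<in> Obj C \<Longrightarrow> t X ;; t' X = \<one> X"
  shows "KB \<bullet> KT t \<bullet> KT t' = KB \<bullet> KI"
proof -
  note [simp] = twistingD(1-4)[OF t(1)] KT_typing[OF t(1)] KT_app[OF t(1)]
    twistingD(1-4)[OF t(2)] KT_typing[OF t(2)] KT_app[OF t(2)]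
  show ?thesis
    by (rule pts_ext2) (simp_all add: eval_simps merge inv comp_id_tens)
qed

text \<open>The crossing involves the domain of the point \<open>v\<close>, so it is an identity for
  either braiding.\<close>

lemma KC_KC:
  assumes "braiding b" "braiding b'" "u \<in> Pts" "v \<in> Pts"
  shows "KC b \<bullet> u \<bullet> v = KC b' \<bullet> u \<bullet> v"
  by (rule pts_ext) (use assms in \<open>simp_all add: eval_simps KC_typing KC_app braidingD\<close>)

end

theorem theorem4p5:
  fixes C :: "('o, 'm, 'r) ribbon_cat_scheme" (structure)
    and A :: 'o and \<phi> :: 'm
  assumes "strict_ribbon_category C"
    and "reflexive_object C A \<phi>"
  shows "balanced_extensional_BCI_algebra
           (Hom C (Unit C) A) (global_app C A \<phi>)
           (close_arrow C A \<phi> 2 1 (app C A \<phi>))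
           (close_arrow C A \<phi> 2 2 (\<sigma> A A))
           (close_arrow C A \<phi> 2 2 (inv_arrow C (\<sigma> A A)))
           (close_arrow C A \<phi> 0 0 (\<one> (Unit C)))
           (close_arrow C A \<phi> 1 1 (\<theta> A))
           (close_arrow C A \<phi> 1 1 (inv_arrow C (\<theta> A)))"
proof -
  interpret reflexive_object C A \<phi>
    by (rule assms(2))
  let ?\<sigma>' = "\<lambda>X Y. inv_arrow C (\<sigma> Y X)" and ?\<theta>' = "\<lambda>X. inv_arrow C (\<theta> X)"
  note b = braiding_braid braiding_inv_braid and t = twisting_twist twisting_inv_twist
  have "balanced_extensional_BCI_algebra Pts ap KB (KC \<sigma>) (KC ?\<sigma>') KI (KT \<theta>) (KT ?\<theta>')"
  proof unfold_locales
    fix D a b c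
    assume "D \<in> {KC \<sigma>, KC ?\<sigma>'}" "a \<in> Pts" "b \<in> Pts" "c \<in> Pts"
    then show "D \<bullet> a \<bullet> b \<bullet> c = a \<bullet> c \<bullet> b"
      using KC_eq b by auto
  next
    fix D
    assume D: "D \<in> {KC \<sigma>, KC ?\<sigma>'}"
    \<comment> \<open>Either sign is \<open>KC\<close> of some braiding, so the lemmas for an
      arbitrary braiding cover all sign choices.\<close>
    then obtain s where s: "D = KC s" "braiding s"
      using b by auto
    show "D \<bullet> KB \<bullet> KI = KB \<bullet> KI"
      using KC_KB_KI s by simp
    show "KB \<bullet> (D \<bullet> KB \<bullet> KB) \<bullet> (KB \<bullet> KB \<bullet> KB) = KB \<bullet> (KB \<bullet> KB) \<bullet> KB"
      using KC_KB_KB s by simp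
    show "KB \<bullet> (KB \<bullet> D) \<bullet> (KB \<bullet> D \<bullet> (KB \<bullet> D)) = KB \<bullet> D \<bullet> (KB \<bullet> (KB \<bullet> D) \<bullet> D)"
      using KC_yang_baxter s by simp
    show "KB \<bullet> (KB \<bullet> KB) \<bullet> D = KB \<bullet> D \<bullet> (KB \<bullet> (KB \<bullet> D) \<bullet> KB)"
      using KB_KB_KC s by simp
    fix E
    assume "E \<in> {KC \<sigma>, KC ?\<sigma>'}"
    then obtain s' where s': "E = KC s'" "braiding s'"
      using b by auto
    show "KB \<bullet> (D \<bullet> KB \<bullet> E) \<bullet> (KB \<bullet> KB \<bullet> KB) = KB \<bullet> (KB \<bullet> E) \<bullet> (KB \<bullet> KB \<bullet> KB)"
      using KC_KB_KC s s' by simp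
    fix T a
    assume "T \<in> {KT \<theta>, KT ?\<theta>'}" "a \<in> Pts"
    then show "D \<bullet> T \<bullet> a = E \<bullet> KI \<bullet> a"
      using KC_KT s s' t by auto
  next
    fix D D'
    assume "(D, D') \<in> {(KC \<sigma>, KC ?\<sigma>'), (KC ?\<sigma>', KC \<sigma>)}"
    then show "KB \<bullet> D \<bullet> D' = KB \<bullet> (KB \<bullet> KI)"
      using KC_inverse[OF b(1) b(2)] KC_inverse[OF b(2) b(1)] by auto
  next
    fix T D
    assume "T \<in> {KT \<theta>, KT ?\<theta>'}" "D \<in> {KC \<sigma>, KC ?\<sigma>'}"
    then show "KB \<bullet> (KB \<bullet> T) \<bullet> KB = KB \<bullet> (D \<bullet> KB \<bullet> T) \<bullet> KB"
      using KB_KT b t by auto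
  next
    fix T T'
    assume "(T, T') \<in> {(KT \<theta>, KT ?\<theta>'), (KT ?\<theta>', KT \<theta>)}"
    then show "KB \<bullet> T \<bullet> T' = KB \<bullet> KI"
      using KT_inverse[OF t(1) t(2)] KT_inverse[OF t(2) t(1)] by auto
  next
    fix T D
    assume "(T, D) \<in> {(KT \<theta>, KC \<sigma>), (KT ?\<theta>', KC ?\<sigma>')}"
    then show "KB \<bullet> KB \<bullet> T = KB \<bullet> T \<bullet> (KB \<bullet> D \<bullet> (KB \<bullet> T \<bullet> (KB \<bullet> D \<bullet> KB)))"
      using KB_comp_KT[OF b(1) t(1) balance_twist] KB_comp_KT[OF b(2) t(2) balance_inv_twist] by auto
  \<comment> \<open>What remains are the closure conditions, the equations for \<open>B\<close> and
    \<open>I\<close> on points, \<open>KC_KC\<close> and \<open>KB_KI\<close>.\<close>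
  qed (auto simp: KB_KI KC_KC b KC_typing KT_typing[OF t(1)] KT_typing[OF t(2)] hom_iff)
  then show ?thesis
    by (simp add: KB_def KC_def KI_def KT_def)
qed

end
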